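(* Assume that $\{\omega,\varepsilon\}$ is a local extremizer (i.e., a local minimizer or a local maximizer) of the decay rate $\mathrm{Dr}$ for an admissible frequency $\alpha=\operatorname{Re}\omega$. Then the boundary value problem $$E(0)=0,\qquad \mathrm{i}\,\omega\,\frac{\sqrt{\varepsilon_\infty}}{c}\,E(l)=E'(l)$$ for the nonlinear equation $$E''(s)=-\frac{\omega^2}{c^2}\,E(s)\left[\varepsilon_1+(\varepsilon_2-\varepsilon_1)\,\chi_{+}\!\left(E^2(s)\right)\right],\qquad 0<s<l,$$ has a nontrivial (complex-valued) solution $E$ satisfying $$\varepsilon(s)=\varepsilon_1+(\varepsilon_2-\varepsilon_1)\,\chi_{+}\!\left(E^2(s)\right)\quad\text{for almost every } s\in(0,l).$$
   Context: Fixed constants: $l>0$ (cavity length), $c>0$ (speed of light), $\varepsilon_\infty\ge 1$ (permittivity of the outer medium), and $1\le\varepsilon_1<\varepsilon_2$. For $\zeta\in\mathbb{C}$, $\chi_{+}(\zeta)=1$ if $\operatorname{Im}\zeta>0$ and $\chi_{+}(\zeta)=0$ if $\operatorname{Im}\zeta\le 0$. An admissible cavity is a real function $\varepsilon\in L^\infty(0,l)$ with $\varepsilon_1\le\varepsilon(s)\le\varepsilon_2$ for almost every $s\in(0,l)$. A number $\omega\in\mathbb{C}$ is a quasi-normal (QN) eigenvalue of $\varepsilon$ if the problem $E''(s)=-\frac{\omega^2}{c^2}\varepsilon(s)E(s)$ on $(0,l)$, $E(0)=0$, $\mathrm{i}\omega\frac{\sqrt{\varepsilon_\infty}}{c}E(l)=E'(l)$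 has a nontrivial (not identically zero) complex-valued solution $E$. All differential equations are understood almost everywhere, with $E$ and $E'$ absolutely continuous on $[0,l]$. If $\varepsilon$ is an admissible cavity and $\omega$ is a QN eigenvalue of $\varepsilon$, then $\{\omega,\varepsilon\}$ is called an admissible pair, and its decay rate is $\mathrm{Dr}(\omega,\varepsilon)=-\operatorname{Im}\omega$. A real number $\alpha$ is an admissible frequency if $\alpha=\operatorname{Re}\omega$ for some admissible pair $\{\omega,\varepsilon\}$. An admissible pair $\{\omega,\varepsilon\}$ with $\operatorname{Re}\omega=\alpha$ is a local minimizer of $\mathrm{Dr}$ for the frequency $\alpha$ if there exists $\delta>0$ such that $\mathrm{Dr}(\tilde\omega,\tilde\varepsilon)\ge\mathrm{Dr}(\omega,\varepsilon)$ for every admissible pair $\{\tilde\omega,\tilde\varepsilon\}$ satisfying $|\tilde\varepsilon(s)-\varepsilon(s)|<\delta$ for almost all $s\in(0,l)$, $|\tilde\omega-\omega|<\delta$, and $\operatorname{Re}\tilde\omega=\alpha$. A local maximizer is defined in the same way with the inequality $\mathrm{Dr}(\tilde\omega,\tilde\varepsilon)\le\mathrm{Dr}(\omega,\varepsilon)$. *)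

theory Defs
  imports "HOL-Analysis.Analysis"
begin

text \<open>Absolute continuity on \<open>{a..b}\<close> in the classical \<open>\<epsilon>\<close>-\<open>\<delta>\<close> sense.
  The constant \<^const>\<open>absolutely_continuous\<close> of HOL-Analysis is about measures, not functions.\<close>

definition abs_continuous_on :: "real \<Rightarrow> real \<Rightarrow> (real \<Rightarrow> 'a::real_normed_vector) \<Rightarrow> bool" where
  "abs_continuous_on a b f \<longleftrightarrow>
    (\<forall>e>0. \<exists>d>0. \<forall>(n::nat) p q.
      (\<forall>i<n. a \<le> p i \<and> p i \<le> q i \<and> q i \<le> b) \<and>
      disjoint_family_on (\<lambda>i. {p i<..<q i}) {..<n} \<and>
      (\<Sum>i<n. q i - p i) < d
      \<longrightarrow> (\<Sum>i<n. norm (f (q i) - f (p i))) < e)"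

definition chi_plus :: "complex \<Rightarrow> real" where
  "chi_plus z = (if Im z > 0 then 1 else 0)"

text \<open>The two bounds make \<open>\<epsilon>\<close> essentially bounded, so for membership in
  \<open>L\<^sup>\<infinity>(0,l)\<close> only Lebesgue measurability has to be added.
  A cavity is given by a representative; its values off \<open>(0,l)\<close> are irrelevant.\<close>

definition admissible_cavity :: "real \<Rightarrow> real \<Rightarrow> real \<Rightarrow> (real \<Rightarrow> real) \<Rightarrow> bool" where
  "admissible_cavity l \<epsilon>\<^sub>1 \<epsilon>\<^sub>2 \<epsilon> \<longleftrightarrow>
    \<epsilon> \<in> borel_measurable (lebesgue_on {0<..<l}) \<and>
    (AE s in lebesgue_on {0<..<l}. \<epsilon>\<^sub>1 \<le> \<epsilon> s \<and> \<epsilon> s \<le> \<epsilon>\<^sub>2)"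

text \<open>\<open>E'' = F\<close> almost everywhere on \<open>(0,l)\<close> with both boundary conditions. The function \<open>F\<close> may
  depend on \<open>E\<close>, so that the linear and the nonlinear problem are both covered.
  As \<open>E'\<close> is to be absolutely continuous on \<open>[0,l]\<close>, it is the derivative of \<open>E\<close> at every point
  of \<open>[0,l]\<close> (one-sided at the end points).\<close>

definition bvp_solution ::
    "real \<Rightarrow> real \<Rightarrow> real \<Rightarrow> complex \<Rightarrow> (real \<Rightarrow> complex) \<Rightarrow> (real \<Rightarrow> complex) \<Rightarrow> bool" where
  "bvp_solution l c \<epsilon>inf \<omega> F E \<longleftrightarrow>
    (\<exists>E'. abs_continuous_on 0 l E \<and> abs_continuous_on 0 l E' \<and>
      (\<forall>s\<in>{0..l}. (E has_vector_derivative E' s) (at s within {0..l})) \<and>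
      (AE s in lebesgue_on {0<..<l}. (E' has_vector_derivative F s) (at s)) \<and>
      E 0 = 0 \<and>
      \<i> * \<omega> * complex_of_real (sqrt \<epsilon>inf / c) * E l = E' l)"

definition qn_eigenvalue ::
    "real \<Rightarrow> real \<Rightarrow> real \<Rightarrow> (real \<Rightarrow> real) \<Rightarrow> complex \<Rightarrow> bool" where
  "qn_eigenvalue l c \<epsilon>inf \<epsilon> \<omega> \<longleftrightarrow>
    (\<exists>E. bvp_solution l c \<epsilon>inf \<omega>
           (\<lambda>s. - (\<omega>^2 / (complex_of_real c)^2) * complex_of_real (\<epsilon> s) * E s) E \<and>
         (\<exists>s\<in>{0..l}. E s \<noteq> 0))"

definition admissible_pair ::
    "real \<Rightarrow> real \<Rightarrow> real \<Rightarrow> real \<Rightarrow> real \<Rightarrow> complex \<Rightarrow> (real \<Rightarrow> real) \<Rightarrow> bool" where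
  "admissible_pair l c \<epsilon>inf \<epsilon>\<^sub>1 \<epsilon>\<^sub>2 \<omega> \<epsilon> \<longleftrightarrow>
    admissible_cavity l \<epsilon>\<^sub>1 \<epsilon>\<^sub>2 \<epsilon> \<and> qn_eigenvalue l c \<epsilon>inf \<epsilon> \<omega>"

definition decay_rate :: "complex \<Rightarrow> (real \<Rightarrow> real) \<Rightarrow> real" where
  "decay_rate \<omega> \<epsilon> = - Im \<omega>"

definition admissible_frequency ::
    "real \<Rightarrow> real \<Rightarrow> real \<Rightarrow> real \<Rightarrow> real \<Rightarrow> real \<Rightarrow> bool" where
  "admissible_frequency l c \<epsilon>inf \<epsilon>\<^sub>1 \<epsilon>\<^sub>2 \<alpha> \<longleftrightarrow>
    (\<exists>\<omega> \<epsilon>. admissible_pair l c \<epsilon>inf \<epsilon>\<^sub>1 \<epsilon>\<^sub>2 \<omega> \<epsilon> \<and> \<alpha> = Re \<omega>)"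

definition local_minimizer ::
    "real \<Rightarrow> real \<Rightarrow> real \<Rightarrow> real \<Rightarrow> real \<Rightarrow> real \<Rightarrow> complex \<Rightarrow> (real \<Rightarrow> real) \<Rightarrow> bool" where
  "local_minimizer l c \<epsilon>inf \<epsilon>\<^sub>1 \<epsilon>\<^sub>2 \<alpha> \<omega> \<epsilon> \<longleftrightarrow>
    admissible_pair l c \<epsilon>inf \<epsilon>\<^sub>1 \<epsilon>\<^sub>2 \<omega> \<epsilon> \<and> Re \<omega> = \<alpha> \<and>
    (\<exists>\<delta>>0. \<forall>\<omega>' \<epsilon>'.
      admissible_pair l c \<epsilon>inf \<epsilon>\<^sub>1 \<epsilon>\<^sub>2 \<omega>' \<epsilon>' \<and>
      (AE s in lebesgue_on {0<..<l}. \<bar>\<epsilon>' s - \<epsilon> s\<bar> < \<delta>) \<and>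
      cmod (\<omega>' - \<omega>) < \<delta> \<and> Re \<omega>' = \<alpha>
      \<longrightarrow> decay_rate \<omega>' \<epsilon>' \<ge> decay_rate \<omega> \<epsilon>)"

definition local_maximizer ::
    "real \<Rightarrow> real \<Rightarrow> real \<Rightarrow> real \<Rightarrow> real \<Rightarrow> real \<Rightarrow> complex \<Rightarrow> (real \<Rightarrow> real) \<Rightarrow> bool" where
  "local_maximizer l c \<epsilon>inf \<epsilon>\<^sub>1 \<epsilon>\<^sub>2 \<alpha> \<omega> \<epsilon> \<longleftrightarrow>
    admissible_pair l c \<epsilon>inf \<epsilon>\<^sub>1 \<epsilon>\<^sub>2 \<omega> \<epsilon> \<and> Re \<omega> = \<alpha> \<and>
    (\<exists>\<delta>>0. \<forall>\<omega>' \<epsilon>'.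
      admissible_pair l c \<epsilon>inf \<epsilon>\<^sub>1 \<epsilon>\<^sub>2 \<omega>' \<epsilon>' \<and>
      (AE s in lebesgue_on {0<..<l}. \<bar>\<epsilon>' s - \<epsilon> s\<bar> < \<delta>) \<and>
      cmod (\<omega>' - \<omega>) < \<delta> \<and> Re \<omega>' = \<alpha>
      \<longrightarrow> decay_rate \<omega>' \<epsilon>' \<le> decay_rate \<omega> \<epsilon>)"

end

theory Submission
  imports Defs
begin

text \<open>Let \<open>y\<close> be the mode with \<open>y 0 = 0\<close>, \<open>y' 0 = 1\<close>. By the Wronskian identity the
  defect in the boundary condition at \<open>l\<close>, as a function of a perturbation \<open>V\<close> of \<open>\<epsilon>\<close>, is to first order a
  multiple of \<open>\<integral> V y\<^sup>2\<close>. For a complex number \<open>z\<close> take the admissible variation \<open>V\<^sub>z\<close> that pushes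
  \<open>\<epsilon>\<close> towards \<open>\<epsilon>\<^sub>2\<close> where \<open>Re (cnj z * y\<^sup>2) > 0\<close> and towards \<open>\<epsilon>\<^sub>1\<close> where it is negative; then
  \<open>Re (cnj z * \<integral> V\<^sub>z y\<^sup>2) \<ge> 0\<close>. If this is positive for all \<open>z \<noteq> 0\<close>, Brouwer's theorem on a small disc
  of \<open>z\<close> solves the boundary condition for every frequency \<open>\<omega> + \<i> t\<close> with \<open>t\<close> small, so
  \<open>{\<omega>, \<epsilon>}\<close> is not extremal. Hence it
  vanishes for some \<open>u \<noteq> 0\<close>, which means that \<open>\<epsilon>\<close> is bang-bang according to the sign of
  \<open>Re (cnj u * y\<^sup>2)\<close>. The zeros of that function form a null set because the argument of \<open>y\<close> is
  strictly monotone. When \<open>Re \<omega> = 0\<close> the mode is real and the same argument runs over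
  real \<open>z\<close> only.\<close>

section \<open>Absolutely continuous functions and the Lebesgue integral\<close>

text \<open>Where \<epsilon> already equals one of its bounds, only one sign of change is
  admissible. \<open>variation z\<close> is therefore built from positive and negative parts, and
  \<open>response\<close> is Lipschitz and positively homogeneous in \<open>z\<close> but in general
  not linear, so differential calculus in \<open>z\<close> is avoided: Brouwer's theorem asks only
  for continuity and a sign condition on a circle. That condition is robust. On the circle of radius
  r the pairing \<open>Re (cnj z * response z)\<close> is at least m r^2 by compactness, the
  second-order error changes it by at most C r^3, and a frequency shift t by at most a multiple of r
  |t|. Hence r is fixed before t. Both signs of t are reached, which excludes minimizers and
  maximizers alike. The frequency is a parameter and \<open>z\<close> the unknown, so the
  multiplicity of the eigenvalue never enters. If Re \<omega> = 0, then y^2 is real and the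
  direction z = i gives the zero variation; its vanishing pairing carries no information, whence the
  restriction to real \<open>z\<close>. Real \<omega> cannot occur, because a real mode cannot meet
  the boundary condition at \<open>l\<close>.\<close>

lemma abs_continuous_has_integral:
  fixes F f :: "real \<Rightarrow> 'a::banach"
  assumes ab: "a \<le> b" and ac: "abs_continuous_on a b F" and N: "negligible N"
    and der: "\<And>x. x \<in> {a..b} - N \<Longrightarrow> (F has_vector_derivative f x) (at x within {a..b})"
  shows "(f has_integral (F b - F a)) {a..b}"
proof (cases "a = b")
  case True then show ?thesis using has_integral_refl(2)[of f a] by simp
next
  case False
  with ab have ab': "a < b" by simp
  \<comment> \<open>Zeroing the integrand on \<open>N\<close> makes tags in \<open>N\<close>
    contribute only increments of \<open>F\<close>; the values of \<open>f\<close> there may be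
    arbitrarily bad. The spike at the end restores \<open>f\<close>.\<close>
  define g where "g x = (if x \<in> N then 0 else f x)" for x
  have "(g has_integral (F b - F a)) {a..b}"
    unfolding has_integral_factor_content_real
  proof (intro allI impI)
    fix e :: real assume e: "e > 0"
    \<comment> \<open>Half of the error budget \<open>e * (b - a)\<close> goes to the intervals
      tagged in \<open>N\<close>, half to the others, where differentiability with tolerance
      \<open>e/2\<close> is used.\<close>
    define e1 where "e1 = e * (b - a) / 2"
    have e1: "e1 > 0" using e ab' by (simp add: e1_def)
    obtain \<delta> where \<delta>: "\<delta> > 0" and ac\<delta>: "\<And>(n::nat) p q. \<lbrakk>\<forall>i<n. a \<le> p i \<and> p i \<le> q i \<and> q i \<le> b;
        disjoint_family_on (\<lambda>i. {p i<..<q i}) {..<n}; (\<Sum>i<n. q i - p i) < \<delta>\<rbrakk>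
        \<Longrightarrow> (\<Sum>i<n. norm (F (q i) - F (p i))) < e1"
      using ac[unfolded abs_continuous_on_def, rule_format, OF e1] by blast
    \<comment> \<open>The gauge confines every interval tagged in \<open>N\<close> to
      \<open>U\<close>. These intervals do not overlap, so their total length is below \<delta> and
      absolute continuity controls the increments of \<open>F\<close> over them.\<close>
    obtain U where U: "open U" "N \<subseteq> U" and UN: "(U - N) \<in> lmeasurable"
      and Um: "emeasure lebesgue (U - N) < ennreal \<delta>"
      using sets_lebesgue_outer_open[OF negligible_imp_sets[OF N] \<delta>] by blast
    have UU: "U = (U - N) \<union> N" using U by blast
    have Ulm: "U \<in> lmeasurable"
      by (subst UU) (intro fmeasurable.Un UN negligible_imp_measurable N)
    have "measure lebesgue U \<le> measure lebesgue (U - N) + measure lebesgue N"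
      using UN N by (subst UU) (intro measure_Un_le, auto dest: fmeasurableD negligible_imp_sets)
    also have "\<dots> < \<delta>"
      using Um UN N \<delta> by (simp add: negligible_imp_measure0 emeasure_eq_measure2 ennreal_less_iff)
    finally have U\<delta>: "measure lebesgue U < \<delta>" .
    have "\<exists>d>0. (x \<in> N \<longrightarrow> ball x d \<subseteq> U) \<and> (x \<in> {a..b} - N \<longrightarrow>
         (\<forall>y\<in>{a..b}. norm (y-x) < d \<longrightarrow> norm (F y - F x - (y-x) *\<^sub>R f x) \<le> (e/2) * norm (y-x)))" for x
    proof (cases "x \<in> N")
      case True
      then show ?thesis using U by (metis DiffD2 open_contains_ball_eq subsetD)
    next
      case xN: False
      show ?thesis
      proof (cases "x \<in> {a..b}")
        case True
        with xN der[of x] have "(F has_vector_derivative f x) (at x within {a..b})" by auto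
        then obtain d where "d > 0" "\<forall>y\<in>{a..b}. norm (y-x) < d \<longrightarrow> norm (F y - F x - (y-x) *\<^sub>R f x) \<le> (e/2) * norm (y-x)"
          unfolding has_vector_derivative_def has_derivative_within_alt using e by (meson half_gt_zero)
        then show ?thesis using xN by blast
      qed (use xN in \<open>auto intro: exI[of _ 1]\<close>)
    qed
    then obtain d where d: "\<And>x. 0 < d x" and dN: "\<And>x. x \<in> N \<Longrightarrow> ball x (d x) \<subseteq> U"
      and dd: "\<And>x y. \<lbrakk>x \<in> {a..b} - N; y \<in> {a..b}; norm (y-x) < d x\<rbrakk>
         \<Longrightarrow> norm (F y - F x - (y-x) *\<^sub>R f x) \<le> (e/2) * norm (y-x)"
      by metis
    show "\<exists>\<gamma>. gauge \<gamma> \<and> (\<forall>p. p tagged_division_of {a..b} \<and> \<gamma> fine p \<longrightarrow>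
      norm ((\<Sum>(x, k)\<in>p. measure lborel k *\<^sub>R g x) - (F b - F a)) \<le> e * measure lborel {a..b})"
    proof (intro exI conjI allI impI; (elim conjE)?)
      show "gauge (\<lambda>x. ball x (d x))" using d gauge_ball_dependent by blast
      fix p assume ptag: "p tagged_division_of {a..b}" and fine: "(\<lambda>x. ball x (d x)) fine p"
      note ptd = tagged_division_ofD[OF ptag]
      have fp: "finite p" using ptd(1) .
      define PN where "PN = {xk \<in> p. fst xk \<in> N}"
      define PM where "PM = {xk \<in> p. fst xk \<notin> N}"
      have fin: "finite PN" "finite PM" "p = PN \<union> PM" "PN \<inter> PM = {}"
        using fp by (auto simp: PN_def PM_def)
      have form: "\<exists>u v. K = {u..v} \<and> u \<le> v \<and> a \<le> u \<and> v \<le> b \<and> u \<le> x \<and> x \<le> v \<and> {u..v} \<subseteq> ball x (d x)"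
        if xK: "(x,K) \<in> p" for x K
      proof -
        obtain u v where K: "K = {u..v}" using ptd(4)[OF xK] by auto
        moreover have "x \<in> K" "K \<subseteq> {a..b}" using ptd(2,3)[OF xK] by auto
        moreover have "K \<subseteq> ball x (d x)" using fine xK by (auto simp: fine_def)
        ultimately show ?thesis by auto
      qed
      let ?D = "\<lambda>(x,K). F (Sup K) - F (Inf K)"
      have FF: "F b - F a = (\<Sum>xK\<in>p. ?D xK)"
        using additive_tagged_division_1[OF ab ptag, of F] by simp
      have LL: "b - a = (\<Sum>(x,K)\<in>p. Sup K - Inf K)"
        using additive_tagged_division_1[OF ab ptag, of "\<lambda>x. x"] by simp
      have "norm (\<Sum>xK\<in>PM. (\<lambda>(x,k). measure lborel k *\<^sub>R g x) xK - ?D xK) \<le> (\<Sum>(x,K)\<in>PM. (e/2) * (Sup K - Inf K))"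
      proof (rule sum_norm_le)
        fix xK assume xK: "xK \<in> PM"
        \<comment> \<open>The tag lies between the end points \<open>u\<close> and \<open>v\<close>,
          so the two errors, measured from the tag, add up to a multiple of exactly
          \<open>v - u\<close>.\<close>
        obtain x K where [simp]: "xK = (x,K)" by (cases xK)
        from xK have xp: "(x,K) \<in> p" and xN: "x \<notin> N" by (auto simp: PM_def)
        obtain u v where K: "K = {u..v}" "u \<le> v" "a \<le> u" "v \<le> b" "u \<le> x" "x \<le> v" "{u..v} \<subseteq> ball x (d x)"
          using form[OF xp] by blast
        have xab: "x \<in> {a..b} - N" using K xN by auto
        have "norm (u - x) < d x" "norm (v - x) < d x"
          using K(7) K(2) by (auto simp: subset_iff dist_real_def)
        then have 1: "norm (F u - F x - (u-x) *\<^sub>R f x) \<le> (e/2) * norm (u-x)"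
          and 2: "norm (F v - F x - (v-x) *\<^sub>R f x) \<le> (e/2) * norm (v-x)"
          using dd[OF xab, of u] dd[OF xab, of v] K(2-4) by simp_all
        have "norm ((v - u) *\<^sub>R f x - (F v - F u)) = norm ((F u - F x - (u-x) *\<^sub>R f x) - (F v - F x - (v-x) *\<^sub>R f x))"
          by (auto simp: algebra_simps)
        also have "\<dots> \<le> (e/2) * norm (u-x) + (e/2) * norm (v-x)"
          using norm_triangle_ineq4 1 2 add_mono order_trans by metis
        also have "\<dots> = (e/2) * (v - u)" using K by (simp add: field_simps)
        finally show "norm ((\<lambda>(x,k). measure lborel k *\<^sub>R g x) xK - ?D xK) \<le> (case xK of (x,K) \<Rightarrow> (e/2) * (Sup K - Inf K))"
          using K xN by (simp add: g_def)
      qed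
      also have "\<dots> \<le> (\<Sum>(x,K)\<in>p. (e/2) * (Sup K - Inf K))"
      proof (rule sum_mono2)
        fix xK assume "xK \<in> p - PM"
        then show "0 \<le> (case xK of (x,K) \<Rightarrow> (e/2) * (Sup K - Inf K))"
          using form e by (cases xK) fastforce
      qed (use fp fin in auto)
      also have "\<dots> = (e/2) * (b - a)"
        unfolding LL sum_distrib_left by (simp add: case_prod_unfold)
      finally have A: "norm (\<Sum>xK\<in>PM. (\<lambda>(x,k). measure lborel k *\<^sub>R g x) xK - ?D xK) \<le> (e/2) * (b - a)" .
      \<comment> \<open>Absolute continuity is phrased for families indexed by an initial segment of
        the naturals, so the intervals tagged in \<open>N\<close> are enumerated.\<close>
      obtain \<phi> where \<phi>: "bij_betw \<phi> {0..<card PN} PN"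
        using ex_bij_betw_nat_finite[OF fin(1)] by blast
      define P Q where "P i = Inf (snd (\<phi> i))" and "Q i = Sup (snd (\<phi> i))" for i
      have \<phi>i: "\<exists>x. \<phi> i = (x, {P i..Q i}) \<and> x \<in> N \<and> (x, {P i..Q i}) \<in> p \<and> P i \<le> Q i \<and> a \<le> P i \<and> Q i \<le> b \<and> {P i..Q i} \<subseteq> U"
        if "i < card PN" for i
      proof -
        obtain x K where xK: "\<phi> i = (x,K)" by (cases "\<phi> i")
        have "(x,K) \<in> PN" using bij_betwE[OF \<phi>] that xK by (metis atLeastLessThan_iff le0)
        then have xp: "(x,K) \<in> p" and xN: "x \<in> N" by (auto simp: PN_def)
        obtain u v where K: "K = {u..v}" "u \<le> v" "a \<le> u" "v \<le> b" "u \<le> x" "x \<le> v" "{u..v} \<subseteq> ball x (d x)"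
          using form[OF xp] by blast
        have "P i = u" "Q i = v" using K by (auto simp: P_def Q_def xK)
        then show ?thesis using K xN xp xK dN[OF xN] by auto
      qed
      have inj: "inj_on \<phi> {..<card PN}" using \<phi> by (simp add: bij_betw_def lessThan_atLeast0)
      have disj: "disjoint_family_on (\<lambda>i. {P i<..<Q i}) {..<card PN}"
        unfolding disjoint_family_on_def
      proof (intro ballI impI)
        fix i j assume ij: "i \<in> {..<card PN}" "j \<in> {..<card PN}" "i \<noteq> j"
        obtain x where x: "\<phi> i = (x, {P i..Q i})" "(x, {P i..Q i}) \<in> p" using \<phi>i[of i] ij by auto
        obtain y where y: "\<phi> j = (y, {P j..Q j})" "(y, {P j..Q j}) \<in> p" using \<phi>i[of j] ij by auto
        have "\<phi> i \<noteq> \<phi> j" using inj ij by (auto dest: inj_onD)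
        then have "interior {P i..Q i} \<inter> interior {P j..Q j} = {}"
          using ptd(5)[OF x(2) y(2)] x y by metis
        then show "{P i<..<Q i} \<inter> {P j<..<Q j} = {}" by simp
      qed
      have "(\<Sum>i<card PN. Q i - P i) = (\<Sum>i<card PN. measure lebesgue {P i<..<Q i})"
        using \<phi>i by (intro sum.cong) fastforce+
      also have "\<dots> = measure lebesgue (\<Union>i<card PN. {P i<..<Q i})"
        using disj by (intro measure_UNION'[symmetric])
          (auto simp: pairwise_def disjnt_def disjoint_family_on_def intro: lmeasurable_open)
      also have "\<dots> \<le> measure lebesgue U"
      proof (rule measure_mono_fmeasurable)
        show "(\<Union>i<card PN. {P i<..<Q i}) \<subseteq> U" using \<phi>i by fastforce
      qed (use Ulm in auto)
      also note U\<delta>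
      finally have "(\<Sum>i<card PN. norm (F (Q i) - F (P i))) < e1"
        using ac\<delta>[of "card PN" P Q] \<phi>i disj by blast
      moreover have "(\<Sum>i<card PN. norm (F (Q i) - F (P i))) = (\<Sum>xK\<in>PN. norm (?D xK))"
      proof -
        have "(\<Sum>xK\<in>PN. norm (?D xK)) = (\<Sum>i\<in>{0..<card PN}. norm (?D (\<phi> i)))"
          by (rule sum.reindex_bij_betw[OF \<phi>, symmetric])
        also have "\<dots> = (\<Sum>i<card PN. norm (F (Q i) - F (P i)))"
          by (intro sum.cong) (auto simp: P_def Q_def case_prod_unfold lessThan_atLeast0)
        finally show ?thesis by simp
      qed
      ultimately have B0: "(\<Sum>xK\<in>PN. norm (?D xK)) < e1" by simp
      have "(\<Sum>xK\<in>PN. (\<lambda>(x,k). measure lborel k *\<^sub>R g x) xK - ?D xK) = (\<Sum>xK\<in>PN. - ?D xK)"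
        by (intro sum.cong) (auto simp: PN_def g_def)
      moreover have "norm (\<Sum>xK\<in>PN. - ?D xK) \<le> (\<Sum>xK\<in>PN. norm (?D xK))"
        by (rule sum_norm_le) (simp only: norm_minus_cancel)
      ultimately have B: "norm (\<Sum>xK\<in>PN. (\<lambda>(x,k). measure lborel k *\<^sub>R g x) xK - ?D xK) \<le> e1"
        using B0 by (simp only:)
      have "(\<Sum>(x, k)\<in>p. measure lborel k *\<^sub>R g x) - (F b - F a)
          = (\<Sum>xK\<in>p. (\<lambda>(x,k). measure lborel k *\<^sub>R g x) xK - ?D xK)"
        unfolding FF by (simp only: sum_subtractf)
      also have "\<dots> = (\<Sum>xK\<in>PN. (\<lambda>(x,k). measure lborel k *\<^sub>R g x) xK - ?D xK) + (\<Sum>xK\<in>PM. (\<lambda>(x,k). measure lborel k *\<^sub>R g x) xK - ?D xK)"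
        unfolding fin(3) by (rule sum.union_disjoint) (use fin in auto)
      finally have "norm ((\<Sum>(x, k)\<in>p. measure lborel k *\<^sub>R g x) - (F b - F a)) \<le> e1 + (e/2) * (b - a)"
        using norm_triangle_le[OF add_mono[OF B A]] by simp
      also have "\<dots> = e * measure lborel {a..b}" using ab' by (simp add: e1_def field_simps)
      finally show "norm ((\<Sum>(x, k)\<in>p. measure lborel k *\<^sub>R g x) - (F b - F a)) \<le> e * measure lborel {a..b}" .
    qed
  qed
  then show ?thesis
    by (rule has_integral_spike[OF N, rotated]) (auto simp: g_def)
qed

lemma lipschitz_abs_continuous_on:
  fixes F :: "real \<Rightarrow> 'a::real_normed_vector"
  assumes L: "\<And>x y. \<lbrakk>a \<le> x; x \<le> y; y \<le> b\<rbrakk> \<Longrightarrow> norm (F y - F x) \<le> L * (y - x)"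
  shows "abs_continuous_on a b F"
  unfolding abs_continuous_on_def
proof (intro allI impI)
  fix e :: real assume e: "e > 0"
  define d where "d = e / (\<bar>L\<bar> + 1)"
  have d: "d > 0" using e by (simp add: d_def)
  show "\<exists>d>0. \<forall>(n::nat) p q.
      (\<forall>i<n. a \<le> p i \<and> p i \<le> q i \<and> q i \<le> b) \<and> disjoint_family_on (\<lambda>i. {p i<..<q i}) {..<n} \<and>
      (\<Sum>i<n. q i - p i) < d \<longrightarrow> (\<Sum>i<n. norm (F (q i) - F (p i))) < e"
  proof (intro exI[of _ d] conjI d allI impI; elim conjE)
    fix n :: nat and p q :: "nat \<Rightarrow> real"
    assume pq: "\<forall>i<n. a \<le> p i \<and> p i \<le> q i \<and> q i \<le> b" and s: "(\<Sum>i<n. q i - p i) < d"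
    have "(\<Sum>i<n. norm (F (q i) - F (p i))) \<le> (\<Sum>i<n. (\<bar>L\<bar> + 1) * (q i - p i))"
    proof (rule sum_mono)
      fix i assume "i \<in> {..<n}"
      then have i: "a \<le> p i" "p i \<le> q i" "q i \<le> b" using pq by auto
      have "L * (q i - p i) \<le> (\<bar>L\<bar> + 1) * (q i - p i)" using i by (intro mult_right_mono) auto
      with L[OF i] show "norm (F (q i) - F (p i)) \<le> (\<bar>L\<bar> + 1) * (q i - p i)" by linarith
    qed
    also have "\<dots> = (\<bar>L\<bar> + 1) * (\<Sum>i<n. q i - p i)" by (simp add: sum_distrib_left)
    also have "\<dots> < (\<bar>L\<bar> + 1) * d" using s by (intro mult_strict_left_mono) auto
    also have "\<dots> = e" by (simp add: d_def)
    finally show "(\<Sum>i<n. norm (F (q i) - F (p i))) < e" .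
  qed
qed

text \<open>Lebesgue differentiation along the cubes with lower corner at \<open>x\<close>, which in
  dimension one are the intervals to the right of \<open>x\<close>. Multiplying by \<open>h\<close>
  gives the form that a derivative estimate needs.\<close>

lemma integrable_right_derivative_ae:
  fixes f :: "real \<Rightarrow> 'b::euclidean_space"
  assumes "\<And>a b. f integrable_on {a..b}"
  obtains N where "negligible N"
    "\<And>x e. \<lbrakk>x \<notin> N; 0 < e\<rbrakk> \<Longrightarrow> \<exists>d>0. \<forall>h. 0 < h \<and> h < d \<longrightarrow> norm (integral {x..x+h} f - h *\<^sub>R f x) \<le> e * h"
proof -
  obtain N where N: "negligible N" and *: "\<And>x e. \<lbrakk>x \<notin> N; 0 < e\<rbrakk> \<Longrightarrow>
      \<exists>d>0. \<forall>h. 0 < h \<and> h < d \<longrightarrow> norm (integral (cbox x (x + h *\<^sub>R One)) f /\<^sub>R h ^ DIM(real) - f x) < e"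
    using integrable_ccontinuous_explicit[of f] assms by (metis box_real(2))
  show thesis
  proof (rule that[OF N])
    fix x e :: real assume xe: "x \<notin> N" "0 < e"
    obtain d where d: "d > 0" "\<And>h. \<lbrakk>0 < h; h < d\<rbrakk> \<Longrightarrow> norm (integral {x..x+h} f /\<^sub>R h - f x) < e"
      using *[OF xe] by auto
    have "norm (integral {x..x+h} f - h *\<^sub>R f x) \<le> e * h" if h: "0 < h" "h < d" for h
    proof -
      have "integral {x..x+h} f - h *\<^sub>R f x = h *\<^sub>R (integral {x..x+h} f /\<^sub>R h - f x)"
        using h by (simp add: scaleR_diff_right)
      then have "norm (integral {x..x+h} f - h *\<^sub>R f x) = h * norm (integral {x..x+h} f /\<^sub>R h - f x)"
        using h by simp
      also have "\<dots> \<le> h * e" using d(2)[OF h] h by (intro mult_left_mono) auto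
      finally show ?thesis by (simp add: mult.commute)
    qed
    then show "\<exists>d>0. \<forall>h. 0 < h \<and> h < d \<longrightarrow> norm (integral {x..x+h} f - h *\<^sub>R f x) \<le> e * h"
      using d(1) by blast
  qed
qed

text \<open>The left half of the derivative at \<open>x\<close> is the right half at
  \<open>-x\<close> for the reflected integrand, so the one-sided result is applied twice.\<close>

lemma indefinite_integral_has_vector_derivative_ae:
  fixes f :: "real \<Rightarrow> 'b::euclidean_space"
  assumes f: "f integrable_on {a..b}"
  obtains N where "negligible N"
    "\<And>x. x \<in> {a<..<b} - N \<Longrightarrow> ((\<lambda>s. integral {a..s} f) has_vector_derivative f x) (at x)"
proof -
  \<comment> \<open>Extension by zero makes the function and its reflection integrable on every
    interval, as the one-sided result requires.\<close>
  define g where "g x = (if x \<in> {a..b} then f x else 0)" for x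
  have gi: "g integrable_on {u..v}" for u v
  proof -
    have "g integrable_on UNIV"
      unfolding g_def by (rule integrable_restrict_UNIV[THEN iffD2, OF f])
    then show ?thesis using integrable_on_subcbox by (metis box_real(2) subset_UNIV)
  qed
  have gm: "(\<lambda>x. g (-x)) integrable_on {u..v}" for u v
    using gi[of "-v" "-u"] Henstock_Kurzweil_Integration.integrable_reflect_real[of g "-u" "-v"] by simp
  obtain N1 where N1: "negligible N1" and D1: "\<And>x e. \<lbrakk>x \<notin> N1; 0 < e\<rbrakk> \<Longrightarrow>
      \<exists>d>0. \<forall>h. 0 < h \<and> h < d \<longrightarrow> norm (integral {x..x+h} g - h *\<^sub>R g x) \<le> e * h"
    using integrable_right_derivative_ae[OF gi] by blast
  obtain N2 where N2: "negligible N2" and D2: "\<And>x e. \<lbrakk>x \<notin> N2; 0 < e\<rbrakk> \<Longrightarrow>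
      \<exists>d>0. \<forall>h. 0 < h \<and> h < d \<longrightarrow> norm (integral {x..x+h} (\<lambda>x. g (-x)) - h *\<^sub>R g (-x)) \<le> e * h"
    using integrable_right_derivative_ae[OF gm] by blast
  \<comment> \<open>\<open>N2\<close> is exceptional for the reflected function and has to be
    carried back through the reflection, which preserves null sets.\<close>
  have N2': "negligible (uminus ` N2)" 
    by (rule negligible_differentiable_image_negligible[OF _ N2]) (auto simp: differentiable_on_def)
  show thesis
  proof (rule that)
    show "negligible (N1 \<union> uminus ` N2)" using N1 N2' by auto
    fix x assume "x \<in> {a<..<b} - (N1 \<union> uminus ` N2)"
    then have x: "a < x" "x < b" "x \<notin> N1" "- x \<notin> N2" by (auto simp: image_iff) 
    have gx: "g x = f x" using x by (simp add: g_def)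
    have fi: "f integrable_on {u..v}" if "a \<le> u" "v \<le> b" for u v
      using f that by (meson atLeastatMost_subset_iff integrable_on_subinterval)
    have gf: "integral {u..v} g = integral {u..v} f" if "a \<le> u" "v \<le> b" for u v
      using that by (intro integral_cong) (auto simp: g_def)
    show "((\<lambda>s. integral {a..s} f) has_vector_derivative f x) (at x)"
      unfolding has_vector_derivative_def has_derivative_within_alt
    proof (intro conjI allI impI)
      show "bounded_linear (\<lambda>xa. xa *\<^sub>R f x)" by (rule bounded_linear_scaleR_left)
      fix e :: real assume e: "0 < e"
      obtain d1 where d1: "d1 > 0" "\<And>h. \<lbrakk>0 < h; h < d1\<rbrakk> \<Longrightarrow> norm (integral {x..x+h} g - h *\<^sub>R g x) \<le> e * h"
        using D1[OF x(3) e] by blast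
      obtain d2 where d2: "d2 > 0" "\<And>h. \<lbrakk>0 < h; h < d2\<rbrakk> \<Longrightarrow> norm (integral {-x..-x+h} (\<lambda>x. g (-x)) - h *\<^sub>R g x) \<le> e * h"
        using D2[OF x(4) e] by auto
      define d where "d = min (min d1 d2) (min (x - a) (b - x))"
      have d: "d > 0" using d1 d2 x by (auto simp: d_def)
      show "\<exists>d>0. \<forall>y\<in>UNIV. norm (y - x) < d \<longrightarrow>
          norm (integral {a..y} f - integral {a..x} f - (y - x) *\<^sub>R f x) \<le> e * norm (y - x)"
      proof (intro exI[of _ d] conjI d ballI impI)
        fix y :: real assume y: "norm (y - x) < d"
        consider "y = x" | "y > x" | "y < x" by linarith
        then show "norm (integral {a..y} f - integral {a..x} f - (y - x) *\<^sub>R f x) \<le> e * norm (y - x)"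
        proof cases
          case 2
          have "integral {a..y} f - integral {a..x} f = integral {x..y} f"
            using Henstock_Kurzweil_Integration.integral_combine[of a x y f] fi[of a y] 2 y x by (auto simp: d_def algebra_simps)
          moreover have "integral {x..y} f = integral {x..y} g" using gf[of x y] 2 x y by (auto simp: d_def)
          ultimately show ?thesis using d1(2)[of "y - x"] 2 y gx by (auto simp: d_def)
        next
          case 3
          have "integral {a..y} f - integral {a..x} f = - integral {y..x} f"
            using Henstock_Kurzweil_Integration.integral_combine[of a y x f] fi[of a x] 3 y x by (auto simp: d_def algebra_simps)
          moreover have "integral {y..x} f = integral {y..x} g" using gf[of y x] 3 x y by (auto simp: d_def)
          moreover have "integral {-x..-x+(x-y)} (\<lambda>x. g (-x)) = integral {y..x} g"
            using Henstock_Kurzweil_Integration.integral_reflect_real[of y x g] by simp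
          moreover have "norm (integral {-x..-x+(x-y)} (\<lambda>x. g (-x)) - (x-y) *\<^sub>R g x) \<le> e * (x-y)"
            using d2(2)[of "x - y"] 3 y by (auto simp: d_def)
          moreover have "- (integral {a..y} f - integral {a..x} f - (y - x) *\<^sub>R f x)
              = integral {y..x} g - (x-y) *\<^sub>R g x"
            using calculation(1,2) by (simp add: gx algebra_simps)
          ultimately have "norm (- (integral {a..y} f - integral {a..x} f - (y - x) *\<^sub>R f x)) \<le> e * (x - y)"
            by presburger
          then show ?thesis using 3 by (simp only: norm_minus_cancel) simp
        qed simp
      qed
    qed
  qed
qed

section \<open>Linear second-order initial value problems with bounded coefficient\<close>

text \<open>Without a zero, the map \<open>- r G / |G|\<close> would send the disc of
  \<open>S\<close> into its boundary circle. At a Brouwer fixed point \<open>G z\<close> is then a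
  negative multiple of \<open>z\<close>, against the sign condition. The subspace \<open>S\<close>
  allows the real line to be treated together with the plane.\<close>

lemma zero_of_inward_field:
  fixes G :: "complex \<Rightarrow> complex"
  assumes S: "subspace S" "closed S" and r: "r > 0"
    and cont: "continuous_on (S \<inter> cball 0 r) G"
    and GS: "\<And>z. z \<in> S \<inter> cball 0 r \<Longrightarrow> G z \<in> S"
    and pos: "\<And>z. \<lbrakk>z \<in> S; norm z = r\<rbrakk> \<Longrightarrow> Re (cnj z * G z) > 0"
  obtains z where "z \<in> S" "norm z \<le> r" "G z = 0"
proof (rule ccontr)
  assume "\<not> thesis"
  with that have nz: "G z \<noteq> 0" if "z \<in> S \<inter> cball 0 r" for z using that by auto
  define h where "h z = - (r / norm (G z)) *\<^sub>R G z" for z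
  obtain z where z: "z \<in> S \<inter> cball 0 r" "h z = z"
  proof (rule brouwer)
    show "compact (S \<inter> cball 0 r)" using S by (simp add: closed_Int_compact)
    show "convex (S \<inter> cball 0 r)" using S by (simp add: convex_Int subspace_imp_convex)
    show "S \<inter> cball 0 r \<noteq> {}" using subspace_0[OF S(1)] r by fastforce
    show "continuous_on (S \<inter> cball 0 r) h"
      unfolding h_def using nz cont by (intro continuous_intros) auto
    show "h \<in> S \<inter> cball 0 r \<rightarrow> S \<inter> cball 0 r"
    proof
      fix z assume z: "z \<in> S \<inter> cball 0 r"
      have "h z \<in> S" unfolding h_def by (intro subspace_scale S(1) GS z)
      moreover have "norm (h z) \<le> r" using r nz[OF z] by (simp add: h_def)
      ultimately show "h z \<in> S \<inter> cball 0 r" by simp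
    qed
  qed
  have n: "norm (h z) = r" using r nz[OF z(1)] by (simp add: h_def)
  with z have zr: "norm z = r" by simp
  have "G z = - (norm (G z) / r) *\<^sub>R z"
    using nz[OF z(1)] r by (subst z(2)[symmetric], simp add: h_def)
  then have "cnj z * G z = - of_real (norm (G z) / r) * (cnj z * z)"
    by (metis (no_types, lifting) mult.left_commute of_real_minus scaleR_conv_of_real)
  also have "\<dots> = of_real (- (norm (G z) / r) * (norm z)\<^sup>2)"
    by (simp add: complex_norm_square mult.commute flip: of_real_power)
  finally have "Re (cnj z * G z) = - (norm (G z) / r) * (norm z)\<^sup>2"
    by (metis Re_complex_of_real)
  also have "\<dots> \<le> 0" using r by simp
  finally show False using pos[of z] z zr by auto
qed

section \<open>Gronwall's inequality and the Volterra form of y'' = q y\<close>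

lemma gronwall:
  fixes f :: "real \<Rightarrow> real"
  assumes cont: "continuous_on {0..l} f" and B: "0 \<le> B"
    and le: "\<And>s. s \<in> {0..l} \<Longrightarrow> f s \<le> A + B * integral {0..s} f" and s: "s \<in> {0..l}"
  shows "f s \<le> A * exp (B * s)"
proof -
  \<comment> \<open>The majorant damped by \<open>exp (- B * t)\<close> is nonincreasing: its
    derivative is \<open>B\<close> times a nonpositive difference.\<close>
  define g where "g t = (A + B * integral {0..t} f) * exp (- B * t)" for t
  define g' where "g' t = B * (f t - (A + B * integral {0..t} f)) * exp (- B * t)" for t
  have d: "(g has_vector_derivative g' t) (at t within {0..s})" if t: "t \<in> {0..s}" for t
  proof -
    have "((\<lambda>t. integral {0..t} f) has_vector_derivative f t) (at t within {0..s})"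
      using integral_has_vector_derivative[of 0 s f t] cont s t by (metis atLeastAtMost_iff atLeastatMost_subset_iff continuous_on_subset order_refl)
    then have "((\<lambda>t. integral {0..t} f) has_real_derivative f t) (at t within {0..s})"
      by (simp add: has_real_derivative_iff_has_vector_derivative)
    then have "(g has_real_derivative g' t) (at t within {0..s})"
      unfolding g_def g'_def by (auto intro!: derivative_eq_intros simp: algebra_simps)
    then show ?thesis by (simp add: has_real_derivative_iff_has_vector_derivative)
  qed
  have "(g' has_integral (g s - g 0)) {0..s}"
    by (rule fundamental_theorem_of_calculus) (use s d in auto)
  then have "((\<lambda>t. - g' t) has_integral - (g s - g 0)) {0..s}" by (rule has_integral_neg)
  then have "0 \<le> - (g s - g 0)"
  proof (rule has_integral_nonneg)
    fix t assume t: "t \<in> {0..s}"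
    have "B * (f t - (A + B * integral {0..t} f)) \<le> 0"
      using le[of t] t s B by (intro mult_nonneg_nonpos) auto
    then show "0 \<le> - g' t" unfolding g'_def by (simp add: mult_nonpos_nonneg)
  qed
  then have "(A + B * integral {0..s} f) * exp (- B * s) \<le> A" by (simp add: g_def)
  then have "(A + B * integral {0..s} f) * exp (- B * s) * exp (B * s) \<le> A * exp (B * s)"
    by (intro mult_right_mono) auto
  then have "A + B * integral {0..s} f \<le> A * exp (B * s)"
    by (simp add: mult.assoc exp_add[symmetric])
  with le[OF s] show ?thesis by linarith
qed

text \<open>The bound holds at every point rather than almost everywhere, so estimates can be made
  pointwise. A coefficient bounded only almost everywhere is first replaced by a clamped
  representative.\<close>

definition bounded_coefficient :: "real \<Rightarrow> real \<Rightarrow> (real \<Rightarrow> complex) \<Rightarrow> bool" where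
  "bounded_coefficient l Q q \<longleftrightarrow>
    q \<in> borel_measurable (lebesgue_on {0..l}) \<and> (\<forall>x\<in>{0..l}. norm (q x) \<le> Q)"

text \<open>The integral equations for y'' = q y with y(0) = a, y'(0) = b and v = y'. For a merely
  measurable \<open>q\<close> this form avoids the exceptional set on which v' = q y may
  fail.\<close>

definition ivp_solution ::
    "real \<Rightarrow> (real \<Rightarrow> complex) \<Rightarrow> complex \<Rightarrow> complex \<Rightarrow> (real \<Rightarrow> complex) \<Rightarrow> (real \<Rightarrow> complex) \<Rightarrow> bool" where
  "ivp_solution l q a b y v \<longleftrightarrow> continuous_on {0..l} y \<and> continuous_on {0..l} v \<and>
    (\<forall>s\<in>{0..l}. y s = a + integral {0..s} v \<and> v s = b + integral {0..s} (\<lambda>x. q x * y x))"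

lemma bounded_coefficient_norm_le:
  assumes "bounded_coefficient l Q q" "x \<in> {0..l}" shows "norm (q x) \<le> \<bar>Q\<bar>"
  using assms unfolding bounded_coefficient_def by (meson abs_ge_self order_trans)

lemma continuous_on_norm_bound:
  fixes y :: "real \<Rightarrow> 'a::real_normed_vector"
  assumes "continuous_on {a..b} y"
  obtains C where "C > 0" "\<And>x. x \<in> {a..b} \<Longrightarrow> norm (y x) \<le> C"
proof -
  have "bounded (y ` {a..b})" using assms compact_continuous_image compact_imp_bounded by blast
  then show thesis using that unfolding bounded_pos by auto
qed

lemma bounded_coefficient_mult_measurable:
  assumes q: "bounded_coefficient l Q q" and y: "continuous_on {0..l} y"
  shows "(\<lambda>x. q x * y x) \<in> borel_measurable (lebesgue_on {0..l})"
  using assms unfolding bounded_coefficient_def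
  by (intro borel_measurable_times) (auto intro: continuous_imp_measurable_on_sets_lebesgue)

lemma bounded_measurable_integrable_on:
  fixes f :: "real \<Rightarrow> 'a::euclidean_space"
  assumes f: "f \<in> borel_measurable (lebesgue_on {a..b})" and bd: "\<And>x. x \<in> {a..b} \<Longrightarrow> norm (f x) \<le> C"
    and uv: "a \<le> u" "v \<le> b"
  shows "f integrable_on {u..v}"
proof -
  have "f integrable_on {a..b}"
    by (rule measurable_bounded_by_integrable_imp_integrable[OF f, of "\<lambda>_. C"]) (use bd in auto)
  then show ?thesis using uv by (meson atLeastatMost_subset_iff integrable_on_subinterval)
qed

lemma bounded_coefficient_mult_integrable:
  assumes q: "bounded_coefficient l Q q" and y: "continuous_on {0..l} y" and uv: "0 \<le> u" "v \<le> l"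
  shows "(\<lambda>x. q x * y x) integrable_on {u..v}"
proof -
  obtain C where C: "C > 0" "\<And>x. x \<in> {0..l} \<Longrightarrow> norm (y x) \<le> C"
    using continuous_on_norm_bound[OF y] by blast
  show ?thesis
  proof (rule bounded_measurable_integrable_on[OF bounded_coefficient_mult_measurable[OF q y] _ uv])
    fix x assume x: "x \<in> {0..l}"
    show "norm (q x * y x) \<le> \<bar>Q\<bar> * C"
      unfolding norm_mult using bounded_coefficient_norm_le[OF q x] C(2)[OF x] by (intro mult_mono) auto
  qed
qed

lemma exp_weight_integral_le:
  fixes L :: real
  assumes "L > 0" "0 \<le> r" shows "integral {0..r} (\<lambda>x. exp (L * x)) \<le> exp (L * r) / L"
proof -
  have "((\<lambda>x. exp (L * x)) has_integral (exp (L * r) / L - exp (L * 0) / L)) {0..r}"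
    by (rule fundamental_theorem_of_calculus)
      (use assms in \<open>auto intro!: derivative_eq_intros simp flip: has_real_derivative_iff_has_vector_derivative\<close>)
  then have "integral {0..r} (\<lambda>x. exp (L * x)) = exp (L * r) / L - 1 / L" by (simp add: integral_unique)
  then show ?thesis using assms by simp
qed

lemma norm_integral_le_weight:
  fixes f :: "real \<Rightarrow> complex"
  assumes f: "f integrable_on {0..r}" and L: "L > 0" and r: "0 \<le> r"
    and bd: "\<And>x. x \<in> {0..r} \<Longrightarrow> norm (f x) \<le> C * exp (L * x)" and C: "0 \<le> C"
  shows "norm (integral {0..r} f) \<le> C / L * exp (L * r)"
proof -
  have "norm (integral {0..r} f) \<le> integral {0..r} (\<lambda>x. C * exp (L * x))"
    by (rule integral_norm_bound_integral[OF f _ bd])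
      (auto intro!: integrable_continuous_real continuous_intros)
  also have "\<dots> = C * integral {0..r} (\<lambda>x. exp (L * x))" by simp
  also have "\<dots> \<le> C * (exp (L * r) / L)"
    using exp_weight_integral_le[OF L r] C by (rule mult_left_mono)
  finally show ?thesis by simp
qed

text \<open>The weight \<open>exp (L * s)\<close> with \<open>L\<^sup>2 > Q\<close> turns the Volterra operator into a contraction.\<close>
lemma ivp_solution_exists:
  assumes q: "bounded_coefficient l Q q" and l: "l \<ge> 0"
  obtains y v where "ivp_solution l q a b y v"
proof -
  define L where "L = \<bar>Q\<bar> + 1"
  have L: "L > 0" "L \<ge> 1" by (auto simp: L_def)
  have Q: "norm (q x) \<le> \<bar>Q\<bar>" if "x \<in> {0..l}" for x
    using bounded_coefficient_norm_le[OF q that] .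
  \<comment> \<open>Each of the two integrations gains a factor \<open>1 / L\<close> in the weighted
    norm, and the coefficient costs \<open>\<bar>Q\<bar>\<close>.\<close>
  define c where "c = \<bar>Q\<bar> / L / L"
  have c: "0 \<le> c" "c < 1"
  proof -
    have "\<bar>Q\<bar> < L" by (simp add: L_def)
    also have "L \<le> L * L" using mult_left_mono[OF L(2), of L] L(1) by simp
    finally have "\<bar>Q\<bar> < L * L" .
    then show "c < 1" "0 \<le> c" using L by (auto simp: c_def field_simps)
  qed
  define J where "J u r = integral {0..r} (\<lambda>x. q x * (exp (L * x) *\<^sub>R u x))" for u :: "real \<Rightarrow> complex" and r
  \<comment> \<open>This is the Volterra operator conjugated by the weight: its fixed point is
    \<open>exp (- L * s)\<close> times the desired solution.\<close>
  define K where "K u s = exp (- L * s) *\<^sub>R (a + integral {0..s} (\<lambda>r. b + J u r))" for u s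
  have Jint: "(\<lambda>x. q x * (exp (L * x) *\<^sub>R u x)) integrable_on {0..r}" if "continuous_on {0..l} u" "r \<le> l" for u r
    by (rule bounded_coefficient_mult_integrable[OF q]) (use that in \<open>auto intro!: continuous_intros\<close>)
  have Jc: "continuous_on {0..l} (J u)" if "continuous_on {0..l} u" for u
    unfolding J_def by (rule indefinite_integral_continuous_1[OF Jint[OF that order_refl]])
  have JIc: "continuous_on {0..l} (\<lambda>s. integral {0..s} (\<lambda>r. b + J u r))" if "continuous_on {0..l} u" for u
    by (intro indefinite_integral_continuous_1 integrable_continuous_real continuous_intros Jc that)
  have Kc: "continuous_on {0..l} (K u)" if "continuous_on {0..l} u" for u
    unfolding K_def by (intro continuous_intros JIc that)
  \<comment> \<open>The Banach space at hand consists of bounded continuous functions on the whole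
    line, so functions on \<open>{0..l}\<close> are extended by constants.\<close>
  define cl where "cl s = max 0 (min l s)" for s
  have cl: "cl s \<in> {0..l}" for s using l by (auto simp: cl_def)
  have clid: "cl s = s" if "s \<in> {0..l}" for s using that by (auto simp: cl_def)
  define T where "T u = Bcontfun (\<lambda>s. K (apply_bcontfun u) (cl s))" for u :: "real \<Rightarrow>\<^sub>C complex"
  have uc: "continuous_on X (apply_bcontfun u)" for u :: "real \<Rightarrow>\<^sub>C complex" and X
    by (rule continuous_on_apply_bcontfun)
  have T: "apply_bcontfun (T u) s = K (apply_bcontfun u) (cl s)" for u s
  proof -
    have "(\<lambda>s. K (apply_bcontfun u) (cl s)) \<in> bcontfun"
    proof -
      have "continuous_on UNIV (\<lambda>s. K (apply_bcontfun u) (cl s))"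
      proof (rule continuous_on_compose2[OF Kc[OF uc]])
        show "continuous_on UNIV cl" unfolding cl_def by (intro continuous_intros)
      qed (use cl in auto)
      moreover obtain C where "\<And>x. x \<in> {0..l} \<Longrightarrow> norm (K (apply_bcontfun u) x) \<le> C"
        using continuous_on_norm_bound[OF Kc[OF uc]] by blast
      then have "bounded (range (\<lambda>s. K (apply_bcontfun u) (cl s)))"
        using cl by (intro boundedI[of _ C]) auto
      ultimately show ?thesis by (simp add: bcontfun_def)
    qed
    then show ?thesis by (simp add: T_def Bcontfun_inverse)
  qed
  have contr: "dist (T u) (T w) \<le> c * dist u w" for u w
  proof (rule dist_bound)
    fix s
    define t where "t = cl s"
    have t: "t \<in> {0..l}" unfolding t_def by (rule cl)
    let ?u = "apply_bcontfun u" and ?w = "apply_bcontfun w"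
    define D where "D = dist u w"
    have D: "D \<ge> 0" "norm (?u x - ?w x) \<le> D" for x
      using dist_bounded[of u x w] by (auto simp: D_def dist_norm)
    have J: "norm (J ?u r - J ?w r) \<le> \<bar>Q\<bar> * D / L * exp (L * r)" if r: "r \<in> {0..l}" for r
    proof -
      have "J ?u r - J ?w r = integral {0..r} (\<lambda>x. q x * (exp (L * x) *\<^sub>R ?u x) - q x * (exp (L * x) *\<^sub>R ?w x))"
        unfolding J_def using r by (intro Henstock_Kurzweil_Integration.integral_diff[symmetric] Jint uc) auto
      also have "norm \<dots> \<le> \<bar>Q\<bar> * D / L * exp (L * r)"
      proof (rule norm_integral_le_weight)
        fix x assume x: "x \<in> {0..r}"
        have "norm (q x * (exp (L * x) *\<^sub>R ?u x) - q x * (exp (L * x) *\<^sub>R ?w x))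
           = norm (q x) * norm (?u x - ?w x) * exp (L * x)"
          by (simp add: right_diff_distrib[symmetric] scaleR_diff_right[symmetric] norm_mult)
        also have "\<dots> \<le> \<bar>Q\<bar> * D * exp (L * x)"
          using Q[of x] x r D by (intro mult_right_mono mult_mono) auto
        finally show "norm (q x * (exp (L * x) *\<^sub>R ?u x) - q x * (exp (L * x) *\<^sub>R ?w x)) \<le> \<bar>Q\<bar> * D * exp (L * x)" .
      qed (use r L D Jint uc in \<open>auto intro!: integrable_diff\<close>)
      finally show ?thesis .
    qed
    have iJ: "(\<lambda>r. b + J (apply_bcontfun u) r) integrable_on {0..t}" for u
      using t by (intro integrable_continuous_real continuous_intros continuous_on_subset[OF Jc[OF uc]]) auto
    have "norm (integral {0..t} (\<lambda>r. b + J ?u r) - integral {0..t} (\<lambda>r. b + J ?w r))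
        = norm (integral {0..t} (\<lambda>r. (b + J ?u r) - (b + J ?w r)))"
      using iJ by (simp only: Henstock_Kurzweil_Integration.integral_diff)
    also have "\<dots> \<le> (\<bar>Q\<bar> * D / L) / L * exp (L * t)"
      by (rule norm_integral_le_weight[OF integrable_diff[OF iJ iJ]]) (use t J D L in auto)
    finally have *: "norm (integral {0..t} (\<lambda>r. b + J ?u r) - integral {0..t} (\<lambda>r. b + J ?w r)) \<le> c * D * exp (L * t)"
      by (simp add: c_def field_simps)
    have "norm (K ?u t - K ?w t) = exp (- L * t) * norm (integral {0..t} (\<lambda>r. b + J ?u r) - integral {0..t} (\<lambda>r. b + J ?w r))"
      unfolding K_def scaleR_diff_right[symmetric] by simp
    also have "\<dots> \<le> exp (- L * t) * (c * D * exp (L * t))"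
      using * by (intro mult_left_mono) auto
    also have "\<dots> = c * D" by (simp add: exp_minus field_simps)
    finally show "dist (apply_bcontfun (T u) s) (apply_bcontfun (T w) s) \<le> c * dist u w"
      by (simp add: T t_def dist_norm D_def)
  qed
  obtain u where u: "T u = u" using banach_fix_type[OF c, of T] contr by blast
  define y where "y s = exp (L * s) *\<^sub>R apply_bcontfun u s" for s
  define v where "v s = b + J (apply_bcontfun u) s" for s
  have "ivp_solution l q a b y v"
    unfolding ivp_solution_def
  proof (intro conjI ballI)
    show "continuous_on {0..l} y" unfolding y_def by (intro continuous_intros uc)
    show "continuous_on {0..l} v" unfolding v_def by (intro continuous_intros Jc uc)
    fix s assume s: "s \<in> {0..l}"
    have "apply_bcontfun u s = K (apply_bcontfun u) s" using T[of u s] u clid[OF s] by simp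
    then show "y s = a + integral {0..s} v"
      by (simp add: y_def v_def[abs_def] K_def exp_minus)
    show "v s = b + integral {0..s} (\<lambda>x. q x * y x)" by (simp add: v_def J_def y_def)
  qed
  then show thesis by (rule that)
qed

text \<open>Gronwall for the sum of both differences. The difference of the coefficients meets only
  the second solution, which is why \<open>M\<close> bounds \<open>y2\<close>, while the growth rate
  involves only the bound of \<open>q1\<close>.\<close>

lemma ivp_solution_stability:
  assumes s1: "ivp_solution l q1 a1 b1 y1 v1" and s2: "ivp_solution l q2 a2 b2 y2 v2"
    and q1: "bounded_coefficient l Q q1" and q2: "bounded_coefficient l Q' q2"
    and \<kappa>: "\<And>x. x \<in> {0..l} \<Longrightarrow> norm (q1 x - q2 x) \<le> \<kappa>" and M: "\<And>x. x \<in> {0..l} \<Longrightarrow> norm (y2 x) \<le> M"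
    and s: "s \<in> {0..l}"
  shows "norm (y1 s - y2 s) + norm (v1 s - v2 s)
      \<le> (norm (a1 - a2) + norm (b1 - b2) + \<kappa> * M * l) * exp ((1 + \<bar>Q\<bar>) * l)"
proof -
  define f where "f s = norm (y1 s - y2 s) + norm (v1 s - v2 s)" for s
  define A where "A = norm (a1 - a2) + norm (b1 - b2) + \<kappa> * M * l"
  have l: "0 \<le> l" using s by auto
  have \<kappa>M: "\<kappa> \<ge> 0" "M \<ge> 0" using \<kappa>[OF s] M[OF s] norm_ge_zero order_trans by blast+
  have c: "continuous_on {0..l} y1" "continuous_on {0..l} v1" "continuous_on {0..l} y2" "continuous_on {0..l} v2"
    using s1 s2 by (auto simp: ivp_solution_def)
  have ci: "g integrable_on {0..t}" if "continuous_on {0..l} g" "t \<le> l" for g :: "real \<Rightarrow> 'a::euclidean_space" and t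
    using that by (intro integrable_continuous_real) (auto intro: continuous_on_subset)
  have fc: "continuous_on {0..l} f" unfolding f_def by (intro continuous_intros c)
  have f0: "f x \<ge> 0" for x by (simp add: f_def)
  have "f t \<le> A + (1 + \<bar>Q\<bar>) * integral {0..t} f" if t: "t \<in> {0..l}" for t
  proof -
    have fi: "f integrable_on {0..t}" using t by (intro ci fc) auto
    have 1: "y1 t - y2 t = (a1 - a2) + integral {0..t} (\<lambda>x. v1 x - v2 x)"
      using s1 s2 t by (subst Henstock_Kurzweil_Integration.integral_diff) (auto simp: ivp_solution_def intro!: ci)
    have "norm (integral {0..t} (\<lambda>x. v1 x - v2 x)) \<le> integral {0..t} f"
      using t by (intro integral_norm_bound_integral fi ci continuous_intros c) (auto simp: f_def)
    then have n1: "norm (y1 t - y2 t) \<le> norm (a1 - a2) + integral {0..t} f"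
      unfolding 1 by (intro norm_triangle_le) simp
    have i1: "(\<lambda>x. q1 x * y1 x) integrable_on {0..t}" using t by (intro bounded_coefficient_mult_integrable[OF q1] c) auto
    have i2: "(\<lambda>x. q2 x * y2 x) integrable_on {0..t}" using t by (intro bounded_coefficient_mult_integrable[OF q2] c) auto
    have 2: "v1 t - v2 t = (b1 - b2) + integral {0..t} (\<lambda>x. q1 x * y1 x - q2 x * y2 x)"
      using s1 s2 t i1 i2 by (subst Henstock_Kurzweil_Integration.integral_diff) (auto simp: ivp_solution_def)
    have "norm (integral {0..t} (\<lambda>x. q1 x * y1 x - q2 x * y2 x)) \<le> integral {0..t} (\<lambda>x. \<bar>Q\<bar> * f x + \<kappa> * M)"
    proof (rule integral_norm_bound_integral)
      fix x assume "x \<in> {0..t}"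
      then have x: "x \<in> {0..l}" using t by auto
      have "norm (q1 x) \<le> \<bar>Q\<bar>" by (rule bounded_coefficient_norm_le[OF q1 x])
      have "q1 x * y1 x - q2 x * y2 x = q1 x * (y1 x - y2 x) + (q1 x - q2 x) * y2 x" by (simp add: algebra_simps)
      also have "norm \<dots> \<le> norm (q1 x) * norm (y1 x - y2 x) + norm (q1 x - q2 x) * norm (y2 x)"
        by (metis norm_mult norm_triangle_ineq)
      also have "\<dots> \<le> \<bar>Q\<bar> * f x + \<kappa> * M"
        using \<open>norm (q1 x) \<le> \<bar>Q\<bar>\<close> \<kappa>[OF x] M[OF x] \<kappa>M by (intro add_mono mult_mono) (auto simp: f_def)
      finally show "norm (q1 x * y1 x - q2 x * y2 x) \<le> \<bar>Q\<bar> * f x + \<kappa> * M" .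
    next
      show "(\<lambda>x. q1 x * y1 x - q2 x * y2 x) integrable_on {0..t}" by (rule integrable_diff[OF i1 i2])
      show "(\<lambda>x. \<bar>Q\<bar> * f x + \<kappa> * M) integrable_on {0..t}" using t by (intro ci continuous_intros fc) auto
    qed
    also have "\<dots> = \<bar>Q\<bar> * integral {0..t} f + t * (\<kappa> * M)"
      using t fi by (subst Henstock_Kurzweil_Integration.integral_add) (auto intro!: ci continuous_intros fc)
    also have "\<dots> \<le> \<bar>Q\<bar> * integral {0..t} f + l * (\<kappa> * M)"
      using t \<kappa>M by (intro add_left_mono mult_right_mono) auto
    finally have n2: "norm (v1 t - v2 t) \<le> norm (b1 - b2) + (\<bar>Q\<bar> * integral {0..t} f + l * (\<kappa> * M))"
      unfolding 2 by (intro norm_triangle_le) simp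
    show ?thesis using n1 n2 by (simp add: f_def[of t] A_def algebra_simps)
  qed
  then have "f s \<le> A * exp ((1 + \<bar>Q\<bar>) * s)"
    by (intro gronwall[OF fc _ _ s]) auto
  also have "\<dots> \<le> A * exp ((1 + \<bar>Q\<bar>) * l)"
  proof (rule mult_left_mono)
    show "exp ((1 + \<bar>Q\<bar>) * s) \<le> exp ((1 + \<bar>Q\<bar>) * l)" using s by (auto intro: mult_left_mono)
    show "0 \<le> A" using \<kappa>M l by (simp add: A_def)
  qed
  finally show ?thesis by (simp add: f_def A_def)
qed

lemma bounded_coefficient_subinterval:
  assumes "bounded_coefficient l Q q" "t \<le> l" shows "bounded_coefficient t Q q"
  using assms unfolding bounded_coefficient_def by (auto intro: measurable_restrict_mono)

lemma ivp_solution_subinterval: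
  assumes "ivp_solution l q a b y v" "t \<le> l" shows "ivp_solution t q a b y v"
  using assms unfolding ivp_solution_def by (auto intro: continuous_on_subset)

lemma ivp_solution_initial:
  assumes "ivp_solution l q a b y v" "0 \<le> l" shows "y 0 = a" "v 0 = b"
  using assms by (auto simp: ivp_solution_def)

lemma ivp_solution_derivative:
  assumes "ivp_solution l q a b y v" "s \<in> {0..l}"
  shows "(y has_vector_derivative v s) (at s within {0..l})"
proof -
  have "((\<lambda>s. a + integral {0..s} v) has_vector_derivative v s) (at s within {0..l})"
    using integral_has_vector_derivative[of 0 l v s] assms
    by (auto simp: ivp_solution_def intro!: derivative_eq_intros)
  then show ?thesis
    by (rule has_vector_derivative_transform[rotated 2]) (use assms in \<open>auto simp: ivp_solution_def\<close>)
qed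

lemma ivp_solution_derivative_ae:
  assumes sol: "ivp_solution l q a b y v" and q: "bounded_coefficient l Q q"
  obtains N where "negligible N"
    "\<And>x. x \<in> {0<..<l} - N \<Longrightarrow> (v has_vector_derivative q x * y x) (at x)"
proof -
  have y: "continuous_on {0..l} y" using sol by (simp add: ivp_solution_def)
  have i: "(\<lambda>x. q x * y x) integrable_on {0..l}"
    by (rule bounded_coefficient_mult_integrable[OF q y]) auto
  obtain N where N: "negligible N" "\<And>x. x \<in> {0<..<l} - N \<Longrightarrow>
      ((\<lambda>s. integral {0..s} (\<lambda>x. q x * y x)) has_vector_derivative q x * y x) (at x)"
    using indefinite_integral_has_vector_derivative_ae[OF i] by blast
  show thesis
  proof (rule that[OF N(1)])
    fix x assume x: "x \<in> {0<..<l} - N"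
    have "((\<lambda>s. b + integral {0..s} (\<lambda>x. q x * y x)) has_vector_derivative q x * y x) (at x)"
      using N(2)[OF x] by (auto intro!: derivative_eq_intros)
    then show "(v has_vector_derivative q x * y x) (at x)"
      by (rule has_vector_derivative_transform_within_open[of _ _ _ "{0<..<l}"])
        (use x sol in \<open>auto simp: ivp_solution_def\<close>)
  qed
qed

lemma integral_Lipschitz:
  fixes g :: "real \<Rightarrow> 'a::euclidean_space"
  assumes g: "g integrable_on {0..l}" and bd: "\<And>x. x \<in> {0..l} \<Longrightarrow> norm (g x) \<le> C"
    and xy: "0 \<le> x" "x \<le> y" "y \<le> l"
  shows "norm (integral {0..y} g - integral {0..x} g) \<le> C * (y - x)"
proof -
  have "g integrable_on {0..y}" "g integrable_on {x..y}"
    using g xy by (meson atLeastatMost_subset_iff integrable_on_subinterval order_refl order_trans)+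
  moreover from this have "integral {0..y} g - integral {0..x} g = integral {x..y} g"
    using Henstock_Kurzweil_Integration.integral_combine[of 0 x y g] xy by (simp add: algebra_simps)
  moreover have "norm (integral {x..y} g) \<le> integral {x..y} (\<lambda>_. C)"
    by (rule integral_norm_bound_integral) (use calculation bd xy in auto)
  ultimately show ?thesis using xy by (simp add: mult.commute)
qed

lemma ivp_solution_Lipschitz:
  assumes sol: "ivp_solution l q a b y v" and q: "bounded_coefficient l Q q"
  obtains C where "C > 0" "\<And>s t. \<lbrakk>0 \<le> s; s \<le> t; t \<le> l\<rbrakk> \<Longrightarrow> norm (y t - y s) \<le> C * (t - s)"
    "\<And>s t. \<lbrakk>0 \<le> s; s \<le> t; t \<le> l\<rbrakk> \<Longrightarrow> norm (v t - v s) \<le> C * (t - s)"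
proof -
  have y: "continuous_on {0..l} y" and v: "continuous_on {0..l} v" using sol by (auto simp: ivp_solution_def)
  obtain C1 where C1: "C1 > 0" "\<And>x. x \<in> {0..l} \<Longrightarrow> norm (y x) \<le> C1"
    using continuous_on_norm_bound[OF y] by blast
  obtain C2 where C2: "C2 > 0" "\<And>x. x \<in> {0..l} \<Longrightarrow> norm (v x) \<le> C2"
    using continuous_on_norm_bound[OF v] by blast
  have qy: "norm (q x * y x) \<le> \<bar>Q\<bar> * C1" if "x \<in> {0..l}" for x
    unfolding norm_mult using bounded_coefficient_norm_le[OF q that] C1 that by (intro mult_mono) auto
  show thesis
  proof (rule that[of "C2 + \<bar>Q\<bar> * C1"])
    show "0 < C2 + \<bar>Q\<bar> * C1" using C1(1) C2(1) by (simp add: add_pos_nonneg)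
    fix s t assume st: "0 \<le> s" "s \<le> t" "t \<le> l"
    have "norm (integral {0..t} v - integral {0..s} v) \<le> C2 * (t - s)"
      by (rule integral_Lipschitz) (use st C2 v in \<open>auto intro: integrable_continuous_real\<close>)
    moreover have "norm (integral {0..t} (\<lambda>x. q x * y x) - integral {0..s} (\<lambda>x. q x * y x)) \<le> \<bar>Q\<bar> * C1 * (t - s)"
      by (rule integral_Lipschitz)
        (use st qy bounded_coefficient_mult_integrable[OF q y] in auto)
    moreover have "y t - y s = integral {0..t} v - integral {0..s} v"
      "v t - v s = integral {0..t} (\<lambda>x. q x * y x) - integral {0..s} (\<lambda>x. q x * y x)"
      using sol st by (auto simp: ivp_solution_def)
    moreover have "0 \<le> C2 * (t - s)" "0 \<le> \<bar>Q\<bar> * C1 * (t - s)" using C1(1) C2(1) st by simp_all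
    ultimately show "norm (y t - y s) \<le> (C2 + \<bar>Q\<bar> * C1) * (t - s)" "norm (v t - v s) \<le> (C2 + \<bar>Q\<bar> * C1) * (t - s)"
      by (simp_all only: distrib_right)
  qed
qed

lemma ivp_solution_abs_continuous:
  assumes "ivp_solution l q a b y v" "bounded_coefficient l Q q"
  shows "abs_continuous_on 0 l y" "abs_continuous_on 0 l v"
  using ivp_solution_Lipschitz[OF assms] lipschitz_abs_continuous_on by metis+

section \<open>Integration by parts, Wronskian and energy identities\<close>

lemma ivp_solution_product_integral:
  assumes sol: "ivp_solution l q a b y v" and q: "bounded_coefficient l Q q" and l: "0 \<le> l"
    and w: "\<And>s. s \<in> {0..l} \<Longrightarrow> (w has_vector_derivative w' s) (at s within {0..l})"
    and w': "continuous_on {0..l} w'"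
  shows "((\<lambda>x. q x * y x * w x + v x * w' x) has_integral (v l * w l - b * w 0)) {0..l}"
proof -
  have y: "continuous_on {0..l} y" and v: "continuous_on {0..l} v" using sol by (auto simp: ivp_solution_def)
  have wc: "continuous_on {0..l} w"
    using w by (meson continuous_on_eq_continuous_within has_vector_derivative_continuous)
  obtain C1 where C1: "C1 > 0" "\<And>x. x \<in> {0..l} \<Longrightarrow> norm (w x) \<le> C1"
    using continuous_on_norm_bound[OF wc] by blast
  obtain C2 where C2: "C2 > 0" "\<And>x. x \<in> {0..l} \<Longrightarrow> norm (v x) \<le> C2"
    using continuous_on_norm_bound[OF v] by blast
  obtain C3 where C3: "C3 > 0" "\<And>x. x \<in> {0..l} \<Longrightarrow> norm (w' x) \<le> C3"
    using continuous_on_norm_bound[OF w'] by blast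
  obtain C where C: "C > 0" "\<And>s t. \<lbrakk>0 \<le> s; s \<le> t; t \<le> l\<rbrakk> \<Longrightarrow> norm (v t - v s) \<le> C * (t - s)"
    using ivp_solution_Lipschitz[OF sol q] by metis
  have wint: "(w' has_integral (w t - w 0)) {0..t}" if "t \<in> {0..l}" for t
    by (rule fundamental_theorem_of_calculus)
      (use that in \<open>auto intro!: has_vector_derivative_within_subset[OF w]\<close>)
  have wL: "norm (w t - w s) \<le> C3 * (t - s)" if "0 \<le> s" "s \<le> t" "t \<le> l" for s t
  proof -
    have "w t - w s = integral {0..t} w' - integral {0..s} w'"
      using wint[of t] wint[of s] that by (auto simp: integral_unique)
    then show ?thesis
      using integral_Lipschitz[of w' l C3 s t] w' C3 that by (auto intro: integrable_continuous_real)
  qed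
  \<comment> \<open>Both factors are bounded and Lipschitz, so the product is Lipschitz and its
    derivative, known only almost everywhere, integrates back to it.\<close>
  have ac: "abs_continuous_on 0 l (\<lambda>x. v x * w x)"
  proof (rule lipschitz_abs_continuous_on)
    fix s t assume st: "0 \<le> s" "s \<le> t" "t \<le> l"
    have "v t * w t - v s * w s = (v t - v s) * w t + v s * (w t - w s)" by (simp add: algebra_simps)
    also have "norm \<dots> \<le> norm (v t - v s) * norm (w t) + norm (v s) * norm (w t - w s)"
      by (metis norm_mult norm_triangle_ineq)
    also have "\<dots> \<le> (C * (t - s)) * C1 + C2 * (C3 * (t - s))"
      using C(2)[OF st] wL[OF st] C1 C2 C3(1) C(1) st by (intro add_mono mult_mono) auto
    finally show "norm (v t * w t - v s * w s) \<le> (C * C1 + C2 * C3) * (t - s)"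
      by (simp add: algebra_simps)
  qed
  obtain N where N: "negligible N" "\<And>x. x \<in> {0<..<l} - N \<Longrightarrow> (v has_vector_derivative q x * y x) (at x)"
    using ivp_solution_derivative_ae[OF sol q] by blast
  have "((\<lambda>x. q x * y x * w x + v x * w' x) has_integral (v l * w l - v 0 * w 0)) {0..l}"
  proof (rule abs_continuous_has_integral[OF l ac])
    show "negligible (N \<union> {0, l})" by (rule negligible_Un[OF N(1)]) simp
    fix x assume x: "x \<in> {0..l} - (N \<union> {0, l})"
    have 1: "(v has_vector_derivative q x * y x) (at x within {0..l})"
      by (rule has_vector_derivative_at_within[OF N(2)]) (use x in auto)
    have 2: "(w has_vector_derivative w' x) (at x within {0..l})" using w x by auto
    show "((\<lambda>x. v x * w x) has_vector_derivative q x * y x * w x + v x * w' x) (at x within {0..l})"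
      using has_vector_derivative_mult[OF 1 2] by (simp only: add.commute)
  qed
  then show ?thesis using ivp_solution_initial[OF sol l] by simp
qed

text \<open>Each equation is integrated against the other solution; the terms \<open>v1 * v2\<close>
  cancel, and what remains at the end points are the Wronskians at \<open>l\<close> and at
  0.\<close>

lemma wronskian_identity:
  assumes s1: "ivp_solution l q1 a1 b1 y1 v1" and s2: "ivp_solution l q2 a2 b2 y2 v2"
    and q1: "bounded_coefficient l Q1 q1" and q2: "bounded_coefficient l Q2 q2" and l: "0 \<le> l"
  shows "((\<lambda>x. (q1 x - q2 x) * y1 x * y2 x) has_integral
      ((v1 l * y2 l - y1 l * v2 l) - (b1 * a2 - a1 * b2))) {0..l}"
proof -
  have c: "continuous_on {0..l} v1" "continuous_on {0..l} v2" using s1 s2 by (auto simp: ivp_solution_def)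
  have "((\<lambda>x. (q1 x * y1 x * y2 x + v1 x * v2 x) - (q2 x * y2 x * y1 x + v2 x * v1 x)) has_integral
     ((v1 l * y2 l - b1 * y2 0) - (v2 l * y1 l - b2 * y1 0))) {0..l}"
    by (intro has_integral_diff ivp_solution_product_integral[OF s1 q1 l] ivp_solution_product_integral[OF s2 q2 l]
        ivp_solution_derivative[OF s1] ivp_solution_derivative[OF s2] c)
  then show ?thesis
    using ivp_solution_initial[OF s1 l] ivp_solution_initial[OF s2 l]
    by (simp add: algebra_simps)
qed

lemma ivp_solution_unique:
  assumes s1: "ivp_solution l q a b y1 v1" and s2: "ivp_solution l q a b y2 v2"
    and q: "bounded_coefficient l Q q" and s: "s \<in> {0..l}"
  shows "y1 s = y2 s" "v1 s = v2 s"
proof -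
  have y2: "continuous_on {0..l} y2" using s2 by (simp add: ivp_solution_def)
  obtain C where C: "C > 0" "\<And>x. x \<in> {0..l} \<Longrightarrow> norm (y2 x) \<le> C"
    using continuous_on_norm_bound[OF y2] by blast
  have "norm (y1 s - y2 s) + norm (v1 s - v2 s) \<le> 0"
    using ivp_solution_stability[OF s1 s2 q q, of 0 C s] C s by simp
  then show "y1 s = y2 s" "v1 s = v2 s"
    by (metis add_nonneg_eq_0_iff antisym eq_iff_diff_eq_0 norm_eq_zero norm_ge_zero add_nonneg_nonneg)+
qed

lemma ivp_solution_bound:
  assumes sol: "ivp_solution l q a b y v" and q: "bounded_coefficient l Q q" and s: "s \<in> {0..l}"
  shows "norm (y s) + norm (v s) \<le> (norm a + norm b) * exp ((1 + \<bar>Q\<bar>) * l)"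
proof -
  have "ivp_solution l q 0 0 (\<lambda>_. 0) (\<lambda>_. 0)" by (simp add: ivp_solution_def)
  from ivp_solution_stability[OF sol this q q, of 0 0 s] show ?thesis using s by simp
qed

text \<open>With the second fundamental solution the Wronskian is constantly 1, which excludes a
  common zero of \<open>y\<close> and \<open>v\<close>.\<close>

lemma ivp_solution_final_nonzero:
  assumes sol: "ivp_solution l q 0 1 y v" and q: "bounded_coefficient l Q q" and l: "0 \<le> l"
  shows "y l \<noteq> 0 \<or> v l \<noteq> 0"
proof -
  obtain y2 v2 where s2: "ivp_solution l q 1 0 y2 v2" using ivp_solution_exists[OF q l] by blast
  from wronskian_identity[OF sol s2 q q l]
  have "((\<lambda>x. 0 :: complex) has_integral ((v l * y2 l - y l * v2 l) - 1)) {0..l}" by simp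
  then have "v l * y2 l - y l * v2 l = 1" by (metis eq_iff_diff_eq_0 has_integral_0 has_integral_unique)
  then show ?thesis by auto
qed

text \<open>For real data the conjugate solves the same initial value problem, hence coincides with
  the solution.\<close>

lemma ivp_solution_real:
  assumes sol: "ivp_solution l q a b y v" and q: "bounded_coefficient l Q q"
    and real: "a \<in> \<real>" "b \<in> \<real>" "\<And>x. x \<in> {0..l} \<Longrightarrow> q x \<in> \<real>" and s: "s \<in> {0..l}"
  shows "y s \<in> \<real>" "v s \<in> \<real>"
proof -
  have "ivp_solution l q a b (\<lambda>x. cnj (y x)) (\<lambda>x. cnj (v x))"
    unfolding ivp_solution_def
  proof (intro conjI ballI)
    show "continuous_on {0..l} (\<lambda>x. cnj (y x))" "continuous_on {0..l} (\<lambda>x. cnj (v x))"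
      using sol by (auto simp: ivp_solution_def intro!: continuous_on_cnj)
    fix t assume t: "t \<in> {0..l}"
    have y: "y t = a + integral {0..t} v" and v: "v t = b + integral {0..t} (\<lambda>x. q x * y x)"
      using sol t by (auto simp: ivp_solution_def)
    show "cnj (y t) = a + integral {0..t} (\<lambda>x. cnj (v x))"
      unfolding y complex_cnj_add integral_cnj using real(1) by (simp only: Reals_cnj_iff)
    have "integral {0..t} (\<lambda>x. cnj (q x * y x)) = integral {0..t} (\<lambda>x. q x * cnj (y x))"
    proof (rule integral_cong)
      fix x assume "x \<in> {0..t}"
      then have "q x \<in> \<real>" using real(3)[of x] t by auto
      then show "cnj (q x * y x) = q x * cnj (y x)" by (simp only: complex_cnj_mult Reals_cnj_iff)
    qed
    then show "cnj (v t) = b + integral {0..t} (\<lambda>x. q x * cnj (y x))"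
      unfolding v complex_cnj_add integral_cnj using real(2) by (simp only: Reals_cnj_iff)
  qed
  from ivp_solution_unique[OF this sol q s] show "y s \<in> \<real>" "v s \<in> \<real>" by (simp_all only: Reals_cnj_iff)
qed

text \<open>Integration by parts against the conjugate of \<open>y\<close>; the boundary term at 0
  disappears because y(0) = 0.\<close>

lemma ivp_solution_energy:
  assumes sol: "ivp_solution l q 0 b y v" and q: "bounded_coefficient l Q q" and s: "s \<in> {0..l}"
  shows "((\<lambda>x. q x * of_real ((cmod (y x))\<^sup>2) + of_real ((cmod (v x))\<^sup>2)) has_integral (cnj (y s) * v s)) {0..s}"
proof -
  have sol': "ivp_solution s q 0 b y v" and q': "bounded_coefficient s Q q"
    using ivp_solution_subinterval[OF sol] bounded_coefficient_subinterval[OF q] s by auto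
  have "((\<lambda>x. q x * y x * cnj (y x) + v x * cnj (v x)) has_integral (v s * cnj (y s) - b * cnj (y 0))) {0..s}"
  proof (rule ivp_solution_product_integral[OF sol' q'])
    show "((\<lambda>x. cnj (y x)) has_vector_derivative cnj (v x)) (at x within {0..s})" if "x \<in> {0..s}" for x
      using bounded_linear.has_vector_derivative[OF bounded_linear_cnj ivp_solution_derivative[OF sol' that]] .
    show "continuous_on {0..s} (\<lambda>x. cnj (v x))"
      using sol' by (auto simp: ivp_solution_def intro!: continuous_intros)
  qed (use s in auto)
  then show ?thesis
    using ivp_solution_initial[OF sol'] s by (simp only: complex_norm_square mult.assoc[symmetric]) (simp add: mult.commute)
qed

section \<open>Rotation of the mode\<close>

text \<open>The imaginary part of \<open>cnj y * y'\<close> is \<open>\<bar>y\<bar>\<^sup>2\<close> times the derivative of the argument of \<open>y\<close>.\<close>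
lemma ivp_solution_rotation:
  assumes sol: "ivp_solution l (\<lambda>x. \<mu> * of_real (\<rho> x)) 0 1 y v"
    and q: "bounded_coefficient l Q (\<lambda>x. \<mu> * of_real (\<rho> x))"
    and \<rho>: "\<And>x. x \<in> {0..l} \<Longrightarrow> \<rho> x \<ge> 1" and s: "0 < s" "s \<le> l"
  shows "Im \<mu> \<noteq> 0 \<Longrightarrow> Im (cnj (y s) * v s) \<noteq> 0" and "\<mu> \<in> \<real> \<Longrightarrow> Re \<mu> > 0 \<Longrightarrow> y s \<noteq> 0"
proof -
  have s': "s \<in> {0..l}" using s by simp
  have sol': "ivp_solution s (\<lambda>x. \<mu> * of_real (\<rho> x)) 0 1 y v"
    using ivp_solution_subinterval[OF sol] s by auto
  have y: "continuous_on {0..s} y" and v: "continuous_on {0..s} v" using sol' by (auto simp: ivp_solution_def)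
  define I where "I = integral {0..s} (\<lambda>x. (cmod (y x))\<^sup>2)"
  have y2: "(\<lambda>x. (cmod (y x))\<^sup>2) integrable_on {0..s}" and v2: "(\<lambda>x. (cmod (v x))\<^sup>2) integrable_on {0..s}"
    by (intro integrable_continuous_real continuous_intros y v)+
  \<comment> \<open>If \<open>y\<close> vanished on the whole interval, the equation would keep
    \<open>v\<close> at its initial value 1, and then y(s) = s would be nonzero.\<close>
  have I: "I > 0"
  proof (rule ccontr)
    assume "\<not> I > 0"
    moreover have "I \<ge> 0" unfolding I_def by (intro Henstock_Kurzweil_Integration.integral_nonneg y2) auto
    ultimately have "I = 0" by simp
    then have z: "\<forall>x\<in>{0..s}. (cmod (y x))\<^sup>2 = 0"
      unfolding I_def using s y by (subst (asm) integral_eq_0_iff) (auto intro!: continuous_intros)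
    have "v t = 1" if t: "t \<in> {0..s}" for t
    proof -
      have "integral {0..t} (\<lambda>x. \<mu> * of_real (\<rho> x) * y x) = integral {0..t} (\<lambda>_. 0)"
        using z t by (intro integral_cong) auto
      then show ?thesis using sol' t by (auto simp: ivp_solution_def)
    qed
    then have "integral {0..s} v = integral {0..s} (\<lambda>_. 1)" by (intro integral_cong) auto
    then have "y s = of_real s" using sol' s by (auto simp: ivp_solution_def scaleR_conv_of_real)
    then show False using z s by auto
  qed
  define W where "W = cnj (y s) * v s"
  note E = ivp_solution_energy[OF sol q s', folded W_def]
  \<comment> \<open>In the energy identity only \<mu> has an imaginary part, so \<open>Im W\<close>
    is \<open>Im \<mu>\<close> times a positive integral.\<close>
  { assume "Im \<mu> \<noteq> 0"
    have "((\<lambda>x. Im \<mu> * (\<rho> x * (cmod (y x))\<^sup>2)) has_integral Im W) {0..s}"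
      using has_integral_linear[OF E bounded_linear_Im] by (simp add: mult.assoc o_def flip: of_real_power of_real_mult)
    from has_integral_mult_right[OF this, of "inverse (Im \<mu>)"]
    have E2: "((\<lambda>x. \<rho> x * (cmod (y x))\<^sup>2) has_integral (inverse (Im \<mu>) * Im W)) {0..s}"
      using \<open>Im \<mu> \<noteq> 0\<close> by (simp add: mult.assoc[symmetric])
    have "I \<le> inverse (Im \<mu>) * Im W"
    proof (rule has_integral_le[OF integrable_integral[OF y2, folded I_def] E2])
      fix x assume "x \<in> {0..s}"
      then have "1 \<le> \<rho> x" using \<rho> s by auto
      then show "(cmod (y x))\<^sup>2 \<le> \<rho> x * (cmod (y x))\<^sup>2" using mult_right_mono[of 1 "\<rho> x" "(cmod (y x))\<^sup>2"] by simp
    qed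
    with I show "Im (cnj (y s) * v s) \<noteq> 0" by (auto simp flip: W_def) }
  \<comment> \<open>Here both terms of the energy density are nonnegative and the first has positive
    integral, so \<open>cnj (y s) * v s\<close> has positive real part.\<close>
  { assume \<mu>: "\<mu> \<in> \<real>" "Re \<mu> > 0"
    have Im: "Im \<mu> = 0" using \<mu> by (simp add: complex_is_Real_iff)
    have E1: "((\<lambda>x. Re \<mu> * (\<rho> x * (cmod (y x))\<^sup>2) + (cmod (v x))\<^sup>2) has_integral Re W) {0..s}"
      using has_integral_linear[OF E bounded_linear_Re] by (simp add: mult.assoc Im o_def flip: of_real_power of_real_mult)
    have "Re \<mu> * I \<le> Re W"
    proof (rule has_integral_le[OF _ E1])
      show "((\<lambda>x. Re \<mu> * (cmod (y x))\<^sup>2) has_integral Re \<mu> * I) {0..s}"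
        unfolding I_def by (intro has_integral_mult_right integrable_integral y2)
      fix x assume "x \<in> {0..s}"
      then have "1 \<le> \<rho> x" using \<rho> s by auto
      then have "(cmod (y x))\<^sup>2 \<le> \<rho> x * (cmod (y x))\<^sup>2" using mult_right_mono[of 1 "\<rho> x" "(cmod (y x))\<^sup>2"] by simp
      then have "Re \<mu> * (cmod (y x))\<^sup>2 \<le> Re \<mu> * (\<rho> x * (cmod (y x))\<^sup>2)" using \<mu> by (intro mult_left_mono) auto
      then show "Re \<mu> * (cmod (y x))\<^sup>2 \<le> Re \<mu> * (\<rho> x * (cmod (y x))\<^sup>2) + (cmod (v x))\<^sup>2" by (simp add: add_increasing2)
    qed
    moreover have "Re \<mu> * I > 0" using \<mu> I by simp
    ultimately show "y s \<noteq> 0" by (auto simp: W_def) }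
qed

text \<open>A zero with nonvanishing derivative is isolated, so the zero set is locally a single
  point.\<close>

lemma negligible_simple_zeros:
  fixes f f' :: "real \<Rightarrow> real"
  assumes "\<And>x. \<lbrakk>x \<in> S; f x = 0\<rbrakk> \<Longrightarrow> (f has_real_derivative f' x) (at x) \<and> f' x \<noteq> 0"
  shows "negligible {x \<in> S. f x = 0}"
proof (subst locally_negligible_alt, clarify)
  fix x assume x: "x \<in> S" "f x = 0"
  then have d: "(f has_real_derivative f' x) (at x)" "f' x \<noteq> 0" using assms[of x] by blast+
  from d(1) have "((\<lambda>y. (f y - f x) / (y - x)) \<longlongrightarrow> f' x) (at x)" by (simp add: has_field_derivative_iff)
  then have "eventually (\<lambda>y. (f y - f x) / (y - x) \<noteq> 0) (at x)" using d(2) by (rule tendsto_imp_eventually_ne)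
  then obtain U where U: "open U" "x \<in> U" "\<And>y. \<lbrakk>y \<in> U; y \<noteq> x\<rbrakk> \<Longrightarrow> (f y - f x) / (y - x) \<noteq> 0"
    unfolding eventually_at_topological by auto
  have "{y \<in> S. f y = 0} \<inter> U = {x}"
  proof (intro equalityI subsetI)
    fix y assume y: "y \<in> {y \<in> S. f y = 0} \<inter> U"
    then show "y \<in> {x}" using U(3)[of y] x by auto
  qed (use x U in auto)
  moreover have "openin (top_of_set {y \<in> S. f y = 0}) ({y \<in> S. f y = 0} \<inter> U)"
    using U(1) by (rule openin_open_Int)
  ultimately show "\<exists>U. openin (top_of_set {x \<in> S. f x = 0}) U \<and> x \<in> U \<and> negligible U"
    by (intro exI[of _ "{x \<in> S. f x = 0} \<inter> U"]) simp
qed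

text \<open>At a zero of the real part, u y^2 is purely imaginary and nonzero, and the rotation of
  \<open>y\<close> turns it off the imaginary axis with nonzero speed. All zeros are therefore
  simple.\<close>

lemma ivp_solution_negligible_rotated_zeros:
  assumes sol: "ivp_solution l (\<lambda>x. \<mu> * of_real (\<rho> x)) 0 1 y v"
    and q: "bounded_coefficient l Q (\<lambda>x. \<mu> * of_real (\<rho> x))"
    and \<rho>: "\<And>x. x \<in> {0..l} \<Longrightarrow> \<rho> x \<ge> 1" and Im: "Im \<mu> \<noteq> 0" and u: "u \<noteq> 0"
  shows "negligible {s \<in> {0<..<l}. Re (u * (y s)\<^sup>2) = 0}"
proof (rule negligible_simple_zeros)
  fix s assume s: "s \<in> {0<..<l}" and zero: "Re (u * (y s)\<^sup>2) = 0"
  have "s \<in> interior {0..l}" "s \<in> {0..l}" using s by auto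
  then have dy: "(y has_vector_derivative v s) (at s)"
    using ivp_solution_derivative[OF sol] at_within_interior by metis
  have "((\<lambda>s. u * (y s * y s)) has_vector_derivative u * (2 * y s * v s)) (at s)"
    using has_vector_derivative_mult[OF has_vector_derivative_const[of u] has_vector_derivative_mult[OF dy dy]]
    by (simp add: algebra_simps)
  then have "((\<lambda>s. Re (u * (y s)\<^sup>2)) has_vector_derivative Re (u * (2 * y s * v s))) (at s)"
    unfolding power2_eq_square by (rule bounded_linear.has_vector_derivative[OF bounded_linear_Re])
  moreover have "Re (u * (2 * y s * v s)) \<noteq> 0"
  proof
    assume z: "Re (u * (2 * y s * v s)) = 0"
    have r: "Im (cnj (y s) * v s) \<noteq> 0"
      using ivp_solution_rotation(1)[OF sol q \<rho> _ _ Im, of s] s by auto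
    then have y0: "y s \<noteq> 0" by auto
    define X where "X = u * (2 * y s * v s)"
    define p where "p = u * (y s)\<^sup>2"
    define W where "W = cnj (y s) * v s"
    \<comment> \<open>Multiplying by |y|^2 factors the derivative through \<open>p = u y^2\<close>
      and \<open>W = cnj y * v\<close>. As \<open>Re p = 0\<close>, only the product of the
      imaginary parts survives.\<close>
    have "X * of_real ((cmod (y s))\<^sup>2) = 2 * p * W"
      unfolding complex_norm_square X_def p_def W_def by (simp add: power2_eq_square)
    then have "Re (X * of_real ((cmod (y s))\<^sup>2)) = Re (2 * p * W)" by simp
    then have "Im p * Im W = 0" using z zero by (simp flip: X_def p_def)
    moreover have "p \<noteq> 0" using u y0 by (simp add: p_def)
    then have "Im p \<noteq> 0" using zero unfolding p_def[symmetric] by (simp add: complex_eq_iff)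
    ultimately show False using r by (simp add: W_def)
  qed
  ultimately show "((\<lambda>s. Re (u * (y s)\<^sup>2)) has_real_derivative Re (u * (2 * y s * v s))) (at s) \<and> Re (u * (2 * y s * v s)) \<noteq> 0"
    by (simp add: has_real_derivative_iff_has_vector_derivative)
qed

section \<open>Perturbation of a mode\<close>

lemma AE_lebesgue_onI:
  assumes "negligible N" "S \<in> sets lebesgue" "\<And>x. x \<in> S - N \<Longrightarrow> P x"
  shows "AE x in lebesgue_on S. P x"
proof -
  have "AE x in lebesgue. x \<notin> N"
    using assms(1) by (simp add: AE_not_in negligible_iff_null_sets)
  then have "AE x in lebesgue. x \<in> S \<longrightarrow> P x"
    by (rule AE_mp) (use assms(3) in auto)
  then show ?thesis using assms(2) by (simp add: AE_restrict_space_iff)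
qed

lemma AE_lebesgue_onE:
  assumes "AE x in lebesgue_on S. P x" "S \<in> sets lebesgue"
  obtains N where "negligible N" "\<And>x. x \<in> S - N \<Longrightarrow> P x"
proof -
  have "AE x in lebesgue. x \<in> S \<longrightarrow> P x" using assms by (simp add: AE_restrict_space_iff)
  then obtain N where "N \<in> null_sets lebesgue" "{x \<in> space lebesgue. \<not> (x \<in> S \<longrightarrow> P x)} \<subseteq> N"
    by (rule AE_E3) auto
  then show thesis by (intro that[of N]) (auto simp: negligible_iff_null_sets)
qed

lemma nonneg_integral_zero_negligible:
  fixes f :: "real \<Rightarrow> real"
  assumes f: "f \<in> borel_measurable (lebesgue_on {a..b})"
    and bd: "\<And>x. x \<in> {a..b} \<Longrightarrow> 0 \<le> f x \<and> f x \<le> C" and I: "integral {a..b} f \<le> 0"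
  shows "negligible {x \<in> {a..b}. f x \<noteq> 0}"
proof -
  have int: "integrable (lebesgue_on {a..b}) f"
  proof (rule measurable_bounded_by_integrable_imp_lebesgue_integrable[OF f])
    show "integrable (lebesgue_on {a..b}) (\<lambda>_. C)" by (intro continuous_imp_integrable_real continuous_intros)
    show "norm (f x) \<le> C" if "x \<in> {a..b}" for x using bd[OF that] by simp
  qed simp
  have S: "{a..b} \<in> sets lebesgue" by simp
  have nn: "AE x in lebesgue_on {a..b}. 0 \<le> f x"
  proof (rule AE_lebesgue_onI[of "{}"])
    show "0 \<le> f x" if "x \<in> {a..b} - {}" for x using bd[of x] that by blast
  qed simp_all
  have "integral\<^sup>L (lebesgue_on {a..b}) f = integral {a..b} f"
    by (rule lebesgue_integral_eq_integral[OF int]) simp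
  then have "integral\<^sup>L (lebesgue_on {a..b}) f = 0"
    using I integral_nonneg_AE[OF nn] by simp
  then have "AE x in lebesgue_on {a..b}. f x = 0"
    using integral_nonneg_eq_0_iff_AE[OF int nn] by simp
  then obtain N where N: "negligible N" "\<And>x. x \<in> {a..b} - N \<Longrightarrow> f x = 0"
    by (rule AE_lebesgue_onE[OF _ S]) blast
  have "{x \<in> {a..b}. f x \<noteq> 0} \<subseteq> N" using N(2) by blast
  with N(1) show ?thesis by (rule negligible_subset)
qed

lemma bvp_solutionI:
  assumes l: "0 < l" and sol: "ivp_solution l q 0 b y v" and q: "bounded_coefficient l Q q"
    and F: "AE s in lebesgue_on {0<..<l}. q s * y s = F s"
    and bc: "v l = \<i> * \<omega> * complex_of_real (sqrt \<epsilon>inf / c) * y l"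
  shows "bvp_solution l c \<epsilon>inf \<omega> F y"
proof -
  obtain N where N: "negligible N" "\<And>x. x \<in> {0<..<l} - N \<Longrightarrow> (v has_vector_derivative q x * y x) (at x)"
    using ivp_solution_derivative_ae[OF sol q] by blast
  have "AE s in lebesgue_on {0<..<l}. (v has_vector_derivative q s * y s) (at s)"
    by (rule AE_lebesgue_onI[OF N(1) _ N(2)]) simp_all
  with F have ae: "AE s in lebesgue_on {0<..<l}. (v has_vector_derivative F s) (at s)"
    by eventually_elim simp
  have "y 0 = 0" by (rule ivp_solution_initial(1)[OF sol]) (use l in simp)
  then show ?thesis
    unfolding bvp_solution_def
    using ivp_solution_abs_continuous[OF sol q] ivp_solution_derivative[OF sol] ae bc[symmetric] by blast
qed

lemma qn_eigenvalueI:
  assumes l: "0 < l" and sol: "ivp_solution l q 0 1 y v" and q: "bounded_coefficient l Q q"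
    and q_def: "\<And>x. q x = - (\<omega>\<^sup>2 / (complex_of_real c)\<^sup>2) * complex_of_real (\<epsilon> x)"
    and bc: "v l = \<i> * \<omega> * complex_of_real (sqrt \<epsilon>inf / c) * y l"
  shows "qn_eigenvalue l c \<epsilon>inf \<epsilon> \<omega>"
proof -
  have "bvp_solution l c \<epsilon>inf \<omega> (\<lambda>s. - (\<omega>\<^sup>2 / (complex_of_real c)\<^sup>2) * complex_of_real (\<epsilon> s) * y s) y"
    by (rule bvp_solutionI[OF l sol q _ bc]) (simp add: q_def)
  moreover have "\<exists>s\<in>{0..l}. y s \<noteq> 0"
    \<comment> \<open>If \<open>y l\<close> were zero, the boundary condition would make
      \<open>v l\<close> zero as well.\<close>
    using ivp_solution_final_nonzero[OF sol q] l bc by (intro bexI[of _ l]) auto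
  ultimately show ?thesis unfolding qn_eigenvalue_def by blast
qed

section \<open>Admissible variations of a cavity around a fixed normalised mode\<close>

locale cavity_mode =
  fixes l c k \<epsilon>\<^sub>1 \<epsilon>\<^sub>2 :: real and \<epsilon> :: "real \<Rightarrow> real" and \<omega> :: complex and y v :: "real \<Rightarrow> complex"
  assumes l: "0 < l" and c: "0 < c" and \<epsilon>12: "1 \<le> \<epsilon>\<^sub>1" "\<epsilon>\<^sub>1 < \<epsilon>\<^sub>2"
    and \<epsilon>_meas: "\<epsilon> \<in> borel_measurable (lebesgue_on {0..l})"
    and \<epsilon>_bounds: "\<And>x. x \<in> {0..l} \<Longrightarrow> \<epsilon>\<^sub>1 \<le> \<epsilon> x \<and> \<epsilon> x \<le> \<epsilon>\<^sub>2"
    and sol: "ivp_solution l (\<lambda>x. - (\<omega>\<^sup>2 / (complex_of_real c)\<^sup>2) * complex_of_real (\<epsilon> x)) 0 1 y v"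
    and bc: "v l = \<i> * \<omega> * complex_of_real k * y l"
begin

definition intensity :: "complex \<Rightarrow> real \<Rightarrow> real" where
  "intensity z s = Re (cnj z * (y s)\<^sup>2)"

text \<open>While |intensity| is at most 1, \<epsilon> moves by the fraction |intensity| of its
  distance to the selected bound, so the result is admissible. Weighting by the intensity itself
  rather than by its sign makes the variation Lipschitz in \<open>z\<close>.\<close>

definition variation :: "complex \<Rightarrow> real \<Rightarrow> real" where
  "variation z s = (\<epsilon>\<^sub>2 - \<epsilon> s) * max 0 (intensity z s) - (\<epsilon> s - \<epsilon>\<^sub>1) * max 0 (- intensity z s)"

definition response :: "complex \<Rightarrow> complex" where
  "response z = integral {0..l} (\<lambda>s. complex_of_real (variation z s) * (y s)\<^sup>2)"

text \<open>A bound on the coefficient that is uniform over all admissible cavities and all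
  frequencies shifted vertically by at most 1.\<close>

definition qbound :: real where "qbound = ((cmod \<omega> + 1)\<^sup>2 / c\<^sup>2) * \<epsilon>\<^sub>2"

text \<open>The a priori bound for initial data 0 and 1 and a coefficient below
  \<open>qbound\<close>; it serves the mode and all its perturbations at once.\<close>

definition ybound :: real where "ybound = exp ((1 + qbound) * l)"

definition coeff :: "real \<Rightarrow> complex \<Rightarrow> real \<Rightarrow> complex" where
  "coeff t z x = - ((\<omega> + \<i> * complex_of_real t)\<^sup>2 / (complex_of_real c)\<^sup>2) * complex_of_real (\<epsilon> x + variation z x)"

lemma y_cont: "continuous_on {0..l} y"
  using sol by (auto simp: ivp_solution_def)

lemma qbound_pos: "qbound > 0"
proof -
  have "0 < (cmod \<omega> + 1)\<^sup>2" by (intro zero_less_power add_nonneg_pos) auto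
  then show ?thesis unfolding qbound_def using c \<epsilon>12 by (intro mult_pos_pos divide_pos_pos) auto
qed

lemma ybound_ge1: "ybound \<ge> 1" using qbound_pos l by (simp add: ybound_def)

lemma variation_0 [simp]: "variation 0 s = 0" by (simp add: variation_def intensity_def)

lemma coeff_0: "coeff 0 0 = (\<lambda>x. - (\<omega>\<^sup>2 / (complex_of_real c)\<^sup>2) * complex_of_real (\<epsilon> x))"
  by (simp add: coeff_def fun_eq_iff)

lemma coeff_norm_le:
  assumes t: "\<bar>t\<bar> \<le> 1" and e: "0 \<le> e" "e \<le> \<epsilon>\<^sub>2"
  shows "norm (- ((\<omega> + \<i> * complex_of_real t)\<^sup>2 / (complex_of_real c)\<^sup>2) * complex_of_real e) \<le> qbound"
proof -
  have "cmod (\<omega> + \<i> * complex_of_real t) \<le> cmod \<omega> + 1"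
    using norm_triangle_ineq[of \<omega> "\<i> * complex_of_real t"] t by (simp add: norm_mult)
  then have "(cmod (\<omega> + \<i> * complex_of_real t))\<^sup>2 / c\<^sup>2 \<le> (cmod \<omega> + 1)\<^sup>2 / c\<^sup>2"
    by (intro divide_right_mono power_mono) auto
  then have "(cmod (\<omega> + \<i> * complex_of_real t))\<^sup>2 / c\<^sup>2 * e \<le> qbound"
    unfolding qbound_def using e by (intro mult_mono) auto
  then show ?thesis using e by (simp add: norm_mult norm_divide norm_power)
qed

lemma mode_bounded_coefficient: "bounded_coefficient l qbound (coeff 0 0)"
  unfolding bounded_coefficient_def
proof (intro conjI ballI)
  show "coeff 0 0 \<in> borel_measurable (lebesgue_on {0..l})"
    unfolding coeff_0
    by (intro borel_measurable_times borel_measurable_const measurable_compose[OF \<epsilon>_meas borel_measurable_of_real])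
  show "norm (coeff 0 0 x) \<le> qbound" if "x \<in> {0..l}" for x
    unfolding coeff_def using \<epsilon>_bounds[OF that] \<epsilon>12 coeff_norm_le[of 0 "\<epsilon> x"] by simp
qed

lemma mode_solution: "ivp_solution l (coeff 0 0) 0 1 y v"
  unfolding coeff_0 by (rule sol)

lemma y_norm_le: "s \<in> {0..l} \<Longrightarrow> cmod (y s) \<le> ybound"
  using ivp_solution_bound[OF mode_solution mode_bounded_coefficient, of s] qbound_pos norm_ge_zero[of "v s"]
  unfolding ybound_def by (simp del: norm_ge_zero)

lemma y_square_norm_le: "s \<in> {0..l} \<Longrightarrow> cmod ((y s)\<^sup>2) \<le> ybound\<^sup>2"
  unfolding norm_power by (intro power_mono y_norm_le) auto

lemma y_final_nonzero: "y l \<noteq> 0"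
  using ivp_solution_final_nonzero[OF mode_solution mode_bounded_coefficient] l bc by auto

text \<open>For \<omega> = 0 the equation is y'' = 0, so \<open>v\<close> stays 1, while the
  boundary condition demands 0. This permits the later division by \<omega>.\<close>

lemma \<omega>_nonzero: "\<omega> \<noteq> 0"
proof
  assume "\<omega> = 0"
  then have "v l = 0" "v l = 1" using bc sol l by (auto simp: ivp_solution_def)
  then show False by simp
qed

lemma intensity_diff: "s \<in> {0..l} \<Longrightarrow> \<bar>intensity z s - intensity z' s\<bar> \<le> ybound\<^sup>2 * cmod (z - z')"
proof -
  assume s: "s \<in> {0..l}"
  have "intensity z s - intensity z' s = Re (cnj (z - z') * (y s)\<^sup>2)"
    by (simp add: intensity_def algebra_simps)
  then have "\<bar>intensity z s - intensity z' s\<bar> \<le> cmod (cnj (z - z') * (y s)\<^sup>2)"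
    using abs_Re_le_cmod by presburger
  also have "\<dots> = cmod (z - z') * cmod ((y s)\<^sup>2)" by (simp only: norm_mult complex_mod_cnj)
  also have "\<dots> \<le> cmod (z - z') * ybound\<^sup>2" using y_square_norm_le[OF s] by (intro mult_left_mono) auto
  finally show ?thesis by (simp add: mult.commute)
qed

lemma variation_diff:
  assumes s: "s \<in> {0..l}"
  shows "\<bar>variation z s - variation z' s\<bar> \<le> (\<epsilon>\<^sub>2 - \<epsilon>\<^sub>1) * ybound\<^sup>2 * cmod (z - z')"
proof -
  let ?a = "\<epsilon>\<^sub>2 - \<epsilon> s" and ?b = "\<epsilon> s - \<epsilon>\<^sub>1" and ?p = "intensity z s" and ?p' = "intensity z' s"
  have ab: "?a \<ge> 0" "?b \<ge> 0" using \<epsilon>_bounds[OF s] by auto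
  have "\<bar>variation z s - variation z' s\<bar> = \<bar>?a * (max 0 ?p - max 0 ?p') + ?b * (max 0 (-?p') - max 0 (-?p))\<bar>"
    by (simp add: variation_def algebra_simps)
  also have "\<dots> \<le> ?a * \<bar>max 0 ?p - max 0 ?p'\<bar> + ?b * \<bar>max 0 (-?p') - max 0 (-?p)\<bar>"
    using ab by (intro order_trans[OF abs_triangle_ineq]) (simp add: abs_mult)
  also have "\<dots> \<le> ?a * \<bar>?p - ?p'\<bar> + ?b * \<bar>?p - ?p'\<bar>"
    using ab by (intro add_mono mult_left_mono) auto
  \<comment> \<open>The distances from \<epsilon> to the two bounds add up to the fixed width of the
    admissible range.\<close>
  also have "\<dots> = (\<epsilon>\<^sub>2 - \<epsilon>\<^sub>1) * \<bar>?p - ?p'\<bar>" by (simp add: algebra_simps)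
  also have "\<dots> \<le> (\<epsilon>\<^sub>2 - \<epsilon>\<^sub>1) * (ybound\<^sup>2 * cmod (z - z'))"
    using intensity_diff[OF s] \<epsilon>12 by (intro mult_left_mono) auto
  finally show ?thesis by (simp add: mult.assoc)
qed

lemma variation_abs_le:
  assumes "s \<in> {0..l}" shows "\<bar>variation z s\<bar> \<le> (\<epsilon>\<^sub>2 - \<epsilon>\<^sub>1) * ybound\<^sup>2 * cmod z"
  using variation_diff[OF assms, of z 0] by simp

lemma variation_bounds:
  assumes s: "s \<in> {0..l}" and z: "ybound\<^sup>2 * cmod z \<le> 1"
  shows "\<epsilon>\<^sub>1 \<le> \<epsilon> s + variation z s" "\<epsilon> s + variation z s \<le> \<epsilon>\<^sub>2"
proof -
  have p: "\<bar>intensity z s\<bar> \<le> 1" using intensity_diff[OF s, of z 0] z by (simp add: intensity_def)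
  note b = \<epsilon>_bounds[OF s]
  have "(\<epsilon>\<^sub>2 - \<epsilon> s) * max 0 (intensity z s) \<le> (\<epsilon>\<^sub>2 - \<epsilon> s) * 1" "(\<epsilon> s - \<epsilon>\<^sub>1) * max 0 (- intensity z s) \<le> (\<epsilon> s - \<epsilon>\<^sub>1) * 1"
    using p b by (intro mult_left_mono; simp)+
  moreover have "0 \<le> (\<epsilon>\<^sub>2 - \<epsilon> s) * max 0 (intensity z s)" "0 \<le> (\<epsilon> s - \<epsilon>\<^sub>1) * max 0 (- intensity z s)"
    using b by simp_all
  ultimately show "\<epsilon>\<^sub>1 \<le> \<epsilon> s + variation z s" "\<epsilon> s + variation z s \<le> \<epsilon>\<^sub>2"
    unfolding variation_def by simp_all
qed

lemma intensity_measurable: "intensity z \<in> borel_measurable (lebesgue_on {0..l})"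
  unfolding intensity_def
  by (intro continuous_imp_measurable_on_sets_lebesgue continuous_intros y_cont) auto

lemma variation_measurable: "variation z \<in> borel_measurable (lebesgue_on {0..l})"
  unfolding variation_def
  by (intro borel_measurable_times borel_measurable_const borel_measurable_diff borel_measurable_max
      borel_measurable_uminus intensity_measurable \<epsilon>_meas)

lemma coeff_bounded:
  assumes t: "\<bar>t\<bar> \<le> 1" and z: "ybound\<^sup>2 * cmod z \<le> 1"
  shows "bounded_coefficient l qbound (coeff t z)"
  unfolding bounded_coefficient_def
proof (intro conjI ballI)
  show "coeff t z \<in> borel_measurable (lebesgue_on {0..l})"
    unfolding coeff_def
    by (intro borel_measurable_times borel_measurable_const measurable_compose[OF _ borel_measurable_of_real]
        borel_measurable_add \<epsilon>_meas variation_measurable)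
  show "norm (coeff t z x) \<le> qbound" if "x \<in> {0..l}" for x
    unfolding coeff_def using variation_bounds[OF that z] \<epsilon>12 by (intro coeff_norm_le[OF t]) auto
qed

text \<open>The product rule for (\<omega> + i t)^2 times the perturbed cavity, divided by c^2: the
  first summand comes from W^2 - W'^2 = (W - W') (W + W'), the second from the Lipschitz bound of
  the variation.\<close>

definition coeff_lip :: real where
  "coeff_lip = ((2 * cmod \<omega> + 2) * \<epsilon>\<^sub>2 + (cmod \<omega> + 1)\<^sup>2 * ((\<epsilon>\<^sub>2 - \<epsilon>\<^sub>1) * ybound\<^sup>2)) / c\<^sup>2"

lemma coeff_lip_nonneg: "coeff_lip \<ge> 0"
  unfolding coeff_lip_def using \<epsilon>12 by (intro divide_nonneg_nonneg add_nonneg_nonneg mult_nonneg_nonneg) auto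

lemma coeff_diff:
  assumes t: "\<bar>t\<bar> \<le> 1" "\<bar>t'\<bar> \<le> 1" and z: "ybound\<^sup>2 * cmod z \<le> 1" and x: "x \<in> {0..l}"
  shows "norm (coeff t z x - coeff t' z' x) \<le> coeff_lip * (\<bar>t - t'\<bar> + cmod (z - z'))"
proof -
  define W W' where "W = \<omega> + \<i> * complex_of_real t" and "W' = \<omega> + \<i> * complex_of_real t'"
  define e e' where "e = \<epsilon> x + variation z x" and "e' = \<epsilon> x + variation z' x"
  define d where "d = \<bar>t - t'\<bar> + cmod (z - z')"
  have d: "\<bar>t - t'\<bar> \<le> d" "cmod (z - z') \<le> d" "0 \<le> d" by (auto simp: d_def)
  have W: "cmod W \<le> cmod \<omega> + 1" "cmod W' \<le> cmod \<omega> + 1"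
    using norm_triangle_ineq[of \<omega> "\<i> * complex_of_real t"] norm_triangle_ineq[of \<omega> "\<i> * complex_of_real t'"] t
    by (simp_all add: norm_mult W_def W'_def)
  have e: "0 \<le> e" "e \<le> \<epsilon>\<^sub>2" using variation_bounds[OF x z] \<epsilon>12 by (auto simp: e_def)
  have "W\<^sup>2 - W'\<^sup>2 = (W - W') * (W + W')" by (simp add: power2_eq_square algebra_simps)
  also have "W - W' = \<i> * complex_of_real (t - t')" by (simp add: W_def W'_def algebra_simps)
  finally have "cmod (W\<^sup>2 - W'\<^sup>2) = \<bar>t - t'\<bar> * cmod (W + W')"
    by (simp only: norm_mult norm_ii norm_of_real mult_1)
  also have "\<dots> \<le> d * (2 * cmod \<omega> + 2)"
    using d(1) norm_triangle_ineq[of W W'] W by (intro mult_mono) auto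
  finally have 1: "cmod (W\<^sup>2 - W'\<^sup>2) \<le> d * (2 * cmod \<omega> + 2)" .
  have "\<bar>e - e'\<bar> \<le> ((\<epsilon>\<^sub>2 - \<epsilon>\<^sub>1) * ybound\<^sup>2) * cmod (z - z')"
    using variation_diff[OF x, of z z'] by (simp add: e_def e'_def)
  also have "\<dots> \<le> ((\<epsilon>\<^sub>2 - \<epsilon>\<^sub>1) * ybound\<^sup>2) * d" using d(2) \<epsilon>12 by (intro mult_left_mono) auto
  finally have 2: "\<bar>e - e'\<bar> \<le> ((\<epsilon>\<^sub>2 - \<epsilon>\<^sub>1) * ybound\<^sup>2) * d" .
  have "coeff t z x - coeff t' z' x = - ((W\<^sup>2 - W'\<^sup>2) * complex_of_real e + W'\<^sup>2 * complex_of_real (e - e')) / (complex_of_real c)\<^sup>2"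
    by (simp add: coeff_def W_def W'_def e_def e'_def algebra_simps diff_divide_distrib add_divide_distrib)
  then have "norm (coeff t z x - coeff t' z' x) = cmod ((W\<^sup>2 - W'\<^sup>2) * complex_of_real e + W'\<^sup>2 * complex_of_real (e - e')) / c\<^sup>2"
    by (simp only: norm_divide norm_minus_cancel norm_power norm_of_real power2_abs)
  also have "\<dots> \<le> (cmod (W\<^sup>2 - W'\<^sup>2) * e + (cmod W')\<^sup>2 * \<bar>e - e'\<bar>) / c\<^sup>2"
  proof (rule divide_right_mono)
    show "cmod ((W\<^sup>2 - W'\<^sup>2) * complex_of_real e + W'\<^sup>2 * complex_of_real (e - e')) \<le> cmod (W\<^sup>2 - W'\<^sup>2) * e + (cmod W')\<^sup>2 * \<bar>e - e'\<bar>"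
      by (rule order_trans[OF norm_triangle_ineq]) (use e in \<open>simp only: norm_mult norm_power norm_of_real abs_of_nonneg order_refl\<close>)
  qed simp
  also have "\<dots> \<le> (d * (2 * cmod \<omega> + 2) * \<epsilon>\<^sub>2 + (cmod \<omega> + 1)\<^sup>2 * (((\<epsilon>\<^sub>2 - \<epsilon>\<^sub>1) * ybound\<^sup>2) * d)) / c\<^sup>2"
    using 1 2 W(2) e d by (intro divide_right_mono add_mono mult_mono power_mono) auto
  also have "\<dots> = coeff_lip * d" by (simp add: coeff_lip_def algebra_simps)
  finally show ?thesis by (simp add: d_def)
qed

lemma response_integrable: "(\<lambda>s. complex_of_real (variation z s) * (y s)\<^sup>2) integrable_on {0..l}"
proof (rule bounded_measurable_integrable_on)
  show "(\<lambda>s. complex_of_real (variation z s) * (y s)\<^sup>2) \<in> borel_measurable (lebesgue_on {0..l})"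
  proof (rule borel_measurable_times)
    show "(\<lambda>s. complex_of_real (variation z s)) \<in> borel_measurable (lebesgue_on {0..l})"
      by (rule measurable_compose[OF variation_measurable borel_measurable_of_real])
    show "(\<lambda>s. (y s)\<^sup>2) \<in> borel_measurable (lebesgue_on {0..l})"
      by (intro continuous_imp_measurable_on_sets_lebesgue continuous_intros y_cont) auto
  qed
  fix s assume s: "s \<in> {0..l}"
  show "norm (complex_of_real (variation z s) * (y s)\<^sup>2) \<le> (\<epsilon>\<^sub>2 - \<epsilon>\<^sub>1) * ybound\<^sup>2 * cmod z * ybound\<^sup>2"
    using variation_abs_le[OF s] y_square_norm_le[OF s] \<epsilon>12 unfolding norm_mult norm_of_real
    by (intro mult_mono) auto
qed auto

lemma response_Lipschitz:
  "cmod (response z - response z') \<le> l * ((\<epsilon>\<^sub>2 - \<epsilon>\<^sub>1) * ybound\<^sup>2 * ybound\<^sup>2) * cmod (z - z')"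
proof -
  note m = response_integrable
  have diff: "response z - response z' = integral {0..l} (\<lambda>s. complex_of_real (variation z s) * (y s)\<^sup>2 - complex_of_real (variation z' s) * (y s)\<^sup>2)"
    unfolding response_def by (rule Henstock_Kurzweil_Integration.integral_diff[symmetric]) (rule m)+
  have "norm (response z - response z') \<le> integral {0..l} (\<lambda>_. (\<epsilon>\<^sub>2 - \<epsilon>\<^sub>1) * ybound\<^sup>2 * cmod (z - z') * ybound\<^sup>2)"
    unfolding diff
  proof (rule integral_norm_bound_integral[OF integrable_diff[OF m m]])
    fix s assume s: "s \<in> {0..l}"
    have "complex_of_real (variation z s) * (y s)\<^sup>2 - complex_of_real (variation z' s) * (y s)\<^sup>2
       = complex_of_real (variation z s - variation z' s) * (y s)\<^sup>2" by (simp add: algebra_simps)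
    then have "norm (complex_of_real (variation z s) * (y s)\<^sup>2 - complex_of_real (variation z' s) * (y s)\<^sup>2)
       = \<bar>variation z s - variation z' s\<bar> * cmod ((y s)\<^sup>2)" by (simp only: norm_mult norm_of_real)
    also have "\<dots> \<le> (\<epsilon>\<^sub>2 - \<epsilon>\<^sub>1) * ybound\<^sup>2 * cmod (z - z') * ybound\<^sup>2"
      using variation_diff[OF s] y_square_norm_le[OF s] \<epsilon>12 by (intro mult_mono) auto
    finally show "norm (complex_of_real (variation z s) * (y s)\<^sup>2 - complex_of_real (variation z' s) * (y s)\<^sup>2)
       \<le> (\<epsilon>\<^sub>2 - \<epsilon>\<^sub>1) * ybound\<^sup>2 * cmod (z - z') * ybound\<^sup>2" .
  qed (rule integrable_const_ivl)
  also have "\<dots> = l * ((\<epsilon>\<^sub>2 - \<epsilon>\<^sub>1) * ybound\<^sup>2 * ybound\<^sup>2) * cmod (z - z')" using l by simp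
  finally show ?thesis .
qed

lemma response_continuous: "continuous_on UNIV response"
proof -
  define C where "C = l * ((\<epsilon>\<^sub>2 - \<epsilon>\<^sub>1) * ybound\<^sup>2 * ybound\<^sup>2)"
  have "C-lipschitz_on UNIV response"
    using response_Lipschitz l \<epsilon>12 unfolding C_def
    by (intro lipschitz_onI) (auto simp: dist_norm)
  then show ?thesis by (rule lipschitz_on_continuous_on)
qed

text \<open>Scaling by nonnegative reals commutes with \<open>max 0\<close>. This homogeneity
  reduces lower bounds for the response to the unit circle.\<close>

lemma response_scale:
  assumes "0 \<le> r" shows "response (complex_of_real r * z) = complex_of_real r * response z"
proof -
  have i: "intensity (complex_of_real r * z) s = r * intensity z s" for s
    by (simp add: intensity_def mult.assoc)
  have m: "max 0 (r * p) = r * max 0 p" for p :: real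
    using assms by (simp add: max_mult_distrib_left)
  have "variation (complex_of_real r * z) s = r * variation z s" for s
    unfolding variation_def i using m[of "intensity z s"] m[of "- intensity z s"]
    by (simp add: right_diff_distrib)
  then have "(\<lambda>s. complex_of_real (variation (complex_of_real r * z) s) * (y s)\<^sup>2)
      = (\<lambda>s. complex_of_real r * (complex_of_real (variation z s) * (y s)\<^sup>2))"
    by (simp add: mult.assoc)
  then have "response (complex_of_real r * z) = integral {0..l} (\<lambda>s. complex_of_real r * (complex_of_real (variation z s) * (y s)\<^sup>2))"
    by (simp only: response_def)
  also have "\<dots> = complex_of_real r * integral {0..l} (\<lambda>s. complex_of_real (variation z s) * (y s)\<^sup>2)"
    by (rule Henstock_Kurzweil_Integration.integral_mult_right)
  finally show ?thesis by (simp only: response_def)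
qed

section \<open>The boundary defect as a function of frequency shift and variation\<close>

lemma perturbed_solution_diff:
  assumes s1: "ivp_solution l (coeff t z) 0 1 y1 v1" and s2: "ivp_solution l (coeff t' z') 0 1 y2 v2"
    and t: "\<bar>t\<bar> \<le> 1" "\<bar>t'\<bar> \<le> 1" and z: "ybound\<^sup>2 * cmod z \<le> 1" "ybound\<^sup>2 * cmod z' \<le> 1" and s: "s \<in> {0..l}"
  shows "norm (y1 s - y2 s) + norm (v1 s - v2 s) \<le> coeff_lip * ybound * l * ybound * (\<bar>t - t'\<bar> + cmod (z - z'))"
proof -
  have "norm (y1 s - y2 s) + norm (v1 s - v2 s)
      \<le> (norm (0 - 0 :: complex) + norm (1 - 1 :: complex) + (coeff_lip * (\<bar>t - t'\<bar> + cmod (z - z'))) * ybound * l) * exp ((1 + \<bar>qbound\<bar>) * l)"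
  proof (rule ivp_solution_stability[OF s1 s2 coeff_bounded[OF t(1) z(1)] coeff_bounded[OF t(2) z(2)] _ _ s])
    show "norm (coeff t z x - coeff t' z' x) \<le> coeff_lip * (\<bar>t - t'\<bar> + cmod (z - z'))" if "x \<in> {0..l}" for x
      by (rule coeff_diff[OF t z(1) that])
    show "norm (y2 x) \<le> ybound" if "x \<in> {0..l}" for x
      using ivp_solution_bound[OF s2 coeff_bounded[OF t(2) z(2)] that] qbound_pos norm_ge_zero[of "v2 x"]
      unfolding ybound_def by (simp del: norm_ge_zero)
  qed
  also have "\<dots> = coeff_lip * ybound * l * ybound * (\<bar>t - t'\<bar> + cmod (z - z'))"
    using qbound_pos by (simp add: ybound_def mult_ac)
  finally show ?thesis .
qed

text \<open>The factor in front makes \<open>mismatch 0\<close> agree with \<open>response\<close> to first order.\<close>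
definition mismatch :: "real \<Rightarrow> complex \<Rightarrow> complex \<Rightarrow> complex" where
  "mismatch t \<eta> \<nu> = - (y l * (complex_of_real c)\<^sup>2 / \<omega>\<^sup>2) * (\<nu> - \<i> * (\<omega> + \<i> * complex_of_real t) * complex_of_real k * \<eta>)"

lemma mismatch_zero_iff:
  "mismatch t \<eta> \<nu> = 0 \<longleftrightarrow> \<nu> = \<i> * (\<omega> + \<i> * complex_of_real t) * complex_of_real k * \<eta>"
  using y_final_nonzero \<omega>_nonzero c by (simp add: mismatch_def)

text \<open>The contributions are the changes of \<open>v\<close>, of \<open>y\<close> under the
  factor \<omega> + i t, and of that factor itself, the last one against the bound of
  \<open>y\<close>.\<close>

definition mismatch_lip :: real where
  "mismatch_lip = cmod (y l * (complex_of_real c)\<^sup>2 / \<omega>\<^sup>2) *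
     ((1 + (cmod \<omega> + 1) * \<bar>k\<bar>) * (coeff_lip * ybound * l * ybound) + \<bar>k\<bar> * ybound)"

lemma mismatch_lip_nonneg: "mismatch_lip \<ge> 0"
  unfolding mismatch_lip_def using coeff_lip_nonneg ybound_ge1 l
  by (intro mult_nonneg_nonneg add_nonneg_nonneg) auto

lemma mismatch_diff:
  assumes s1: "ivp_solution l (coeff t z) 0 1 y1 v1" and s2: "ivp_solution l (coeff t' z') 0 1 y2 v2"
    and t: "\<bar>t\<bar> \<le> 1" "\<bar>t'\<bar> \<le> 1" and z: "ybound\<^sup>2 * cmod z \<le> 1" "ybound\<^sup>2 * cmod z' \<le> 1"
  shows "norm (mismatch t (y1 l) (v1 l) - mismatch t' (y2 l) (v2 l)) \<le> mismatch_lip * (\<bar>t - t'\<bar> + cmod (z - z'))"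
proof -
  define d where "d = \<bar>t - t'\<bar> + cmod (z - z')"
  define L where "L = coeff_lip * ybound * l * ybound"
  have d: "0 \<le> d" "\<bar>t - t'\<bar> \<le> d" by (auto simp: d_def)
  have lI: "l \<in> {0..l}" using l by simp
  have S: "norm (y1 l - y2 l) + norm (v1 l - v2 l) \<le> L * d"
    unfolding L_def d_def by (rule perturbed_solution_diff[OF s1 s2 t z lI])
  then have S1: "norm (y1 l - y2 l) \<le> L * d" and S2: "norm (v1 l - v2 l) \<le> L * d"
    using norm_ge_zero[of "v1 l - v2 l"] norm_ge_zero[of "y1 l - y2 l"] by linarith+
  have y2: "cmod (y2 l) \<le> ybound"
    using ivp_solution_bound[OF s2 coeff_bounded[OF t(2) z(2)] lI] qbound_pos norm_ge_zero[of "v2 l"]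
    unfolding ybound_def by (simp del: norm_ge_zero)
  define W where "W = \<omega> + \<i> * complex_of_real t"
  have W: "cmod W \<le> cmod \<omega> + 1"
    using norm_triangle_ineq[of \<omega> "\<i> * complex_of_real t"] t by (simp add: norm_mult W_def)
  define A where "A = y l * (complex_of_real c)\<^sup>2 / \<omega>\<^sup>2"
  have "mismatch t (y1 l) (v1 l) - mismatch t' (y2 l) (v2 l)
      = - A * ((v1 l - v2 l) - (\<i> * W * complex_of_real k * (y1 l - y2 l) - complex_of_real (t - t') * complex_of_real k * y2 l))"
    by (simp add: mismatch_def A_def[symmetric] W_def algebra_simps)
  also have "norm \<dots> = cmod A * norm ((v1 l - v2 l) - (\<i> * W * complex_of_real k * (y1 l - y2 l) - complex_of_real (t - t') * complex_of_real k * y2 l))"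
    by (simp only: norm_mult norm_minus_cancel)
  also have "\<dots> \<le> cmod A * (L * d + ((cmod \<omega> + 1) * \<bar>k\<bar> * (L * d) + d * \<bar>k\<bar> * ybound))"
  proof (rule mult_left_mono[OF order_trans[OF norm_triangle_ineq4]])
    have 1: "norm (\<i> * W * complex_of_real k * (y1 l - y2 l)) \<le> (cmod \<omega> + 1) * \<bar>k\<bar> * (L * d)"
      unfolding norm_mult norm_of_real norm_ii mult_1 using W S1 by (intro mult_mono) auto
    have 2: "norm (complex_of_real (t - t') * complex_of_real k * y2 l) \<le> d * \<bar>k\<bar> * ybound"
      unfolding norm_mult norm_of_real using d y2 by (intro mult_mono) auto
    show "norm (v1 l - v2 l) + norm (\<i> * W * complex_of_real k * (y1 l - y2 l) - complex_of_real (t - t') * complex_of_real k * y2 l)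
        \<le> L * d + ((cmod \<omega> + 1) * \<bar>k\<bar> * (L * d) + d * \<bar>k\<bar> * ybound)"
      using S2 order_trans[OF norm_triangle_ineq4 add_mono[OF 1 2]] by (rule add_mono)
  qed simp
  also have "\<dots> = mismatch_lip * d" by (simp add: mismatch_lip_def A_def L_def algebra_simps)
  finally show ?thesis by (simp add: d_def)
qed

text \<open>The Wronskian of the mode and the perturbed solution expresses the defect exactly as the
  integral of \<open>variation z * y * y1\<close>. Replacing \<open>y1\<close> by \<open>y\<close>
  costs O(|z|) under a variation that is itself O(|z|), which leaves a quadratic error.\<close>

lemma mismatch_response:
  assumes s: "ivp_solution l (coeff 0 z) 0 1 y1 v1" and z: "ybound\<^sup>2 * cmod z \<le> 1"
  shows "norm (mismatch 0 (y1 l) (v1 l) - response z)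
      \<le> l * ((\<epsilon>\<^sub>2 - \<epsilon>\<^sub>1) * ybound\<^sup>2 * ybound * (coeff_lip * ybound * l * ybound)) * (cmod z)\<^sup>2"
proof -
  let ?L = "coeff_lip * ybound * l * ybound"
  have q: "bounded_coefficient l qbound (coeff 0 z)" by (rule coeff_bounded) (use z in auto)
  have y1c: "continuous_on {0..l} y1" using s by (simp add: ivp_solution_def)
  have eq: "(coeff 0 0 x - coeff 0 z x) * y x * y1 x = (\<omega>\<^sup>2 / (complex_of_real c)\<^sup>2) * (complex_of_real (variation z x) * y x * y1 x)" for x
    by (simp add: coeff_def algebra_simps add_divide_distrib)
  have A0: "\<omega>\<^sup>2 / (complex_of_real c)\<^sup>2 \<noteq> 0" using \<omega>_nonzero c by simp
  have "((\<lambda>x. (coeff 0 0 x - coeff 0 z x) * y x * y1 x) has_integral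
      ((v l * y1 l - y l * v1 l) - (1 * 0 - 0 * 1))) {0..l}"
    by (rule wronskian_identity[OF mode_solution s mode_bounded_coefficient q]) (use l in simp)
  from has_integral_mult_right[OF this[unfolded eq], of "inverse (\<omega>\<^sup>2 / (complex_of_real c)\<^sup>2)"]
  have "((\<lambda>x. complex_of_real (variation z x) * y x * y1 x) has_integral
      inverse (\<omega>\<^sup>2 / (complex_of_real c)\<^sup>2) * (v l * y1 l - y l * v1 l)) {0..l}"
    by (simp only: mult.assoc[symmetric] left_inverse[OF A0] mult_1 mult_zero_left mult_zero_right diff_zero)
  \<comment> \<open>The boundary condition of the unperturbed mode eliminates \<open>v l\<close>,
    and the factor \<open>y l\<close> comes out of the Wronskian; this is the prefactor of
    \<open>mismatch\<close>.\<close>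
  moreover have "inverse (\<omega>\<^sup>2 / (complex_of_real c)\<^sup>2) * (v l * y1 l - y l * v1 l) = mismatch 0 (y1 l) (v1 l)"
    unfolding mismatch_def bc by (simp add: diff_divide_distrib algebra_simps)
  ultimately have I1: "((\<lambda>x. complex_of_real (variation z x) * y x * y1 x) has_integral mismatch 0 (y1 l) (v1 l)) {0..l}"
    by simp
  have I2: "((\<lambda>x. complex_of_real (variation z x) * (y x)\<^sup>2) has_integral response z) {0..l}"
    unfolding response_def by (rule integrable_integral[OF response_integrable])
  have D: "((\<lambda>x. complex_of_real (variation z x) * y x * y1 x - complex_of_real (variation z x) * (y x)\<^sup>2)
      has_integral (mismatch 0 (y1 l) (v1 l) - response z)) {0..l}"
    by (rule has_integral_diff[OF I1 I2])
  have "norm (mismatch 0 (y1 l) (v1 l) - response z) \<le>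
      (\<epsilon>\<^sub>2 - \<epsilon>\<^sub>1) * ybound\<^sup>2 * cmod z * ybound * (?L * cmod z) * measure lborel {0..l}"
  proof (rule has_integral_bound_real[OF _ finite.emptyI D])
    show "0 \<le> (\<epsilon>\<^sub>2 - \<epsilon>\<^sub>1) * ybound\<^sup>2 * cmod z * ybound * (?L * cmod z)"
      using \<epsilon>12 ybound_ge1 coeff_lip_nonneg l by (intro mult_nonneg_nonneg) auto
    fix x assume "x \<in> {0..l} - {}"
    then have x: "x \<in> {0..l}" by simp
    have "norm (y1 x - y x) + norm (v1 x - v x) \<le> ?L * (\<bar>0 - 0\<bar> + cmod (z - 0))"
      by (rule perturbed_solution_diff[OF s mode_solution _ _ z _ x]) auto
    then have yd: "norm (y1 x - y x) \<le> ?L * cmod z"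
      using norm_ge_zero[of "v1 x - v x"] by (simp del: norm_ge_zero)
    have "complex_of_real (variation z x) * y x * y1 x - complex_of_real (variation z x) * (y x)\<^sup>2
        = complex_of_real (variation z x) * y x * (y1 x - y x)"
      by (simp add: algebra_simps power2_eq_square)
    also have "norm \<dots> \<le> (\<epsilon>\<^sub>2 - \<epsilon>\<^sub>1) * ybound\<^sup>2 * cmod z * ybound * (?L * cmod z)"
      unfolding norm_mult norm_of_real
      using variation_abs_le[OF x] y_norm_le[OF x] yd \<epsilon>12 ybound_ge1 by (intro mult_mono) auto
    finally show "norm (complex_of_real (variation z x) * y x * y1 x - complex_of_real (variation z x) * (y x)\<^sup>2)
        \<le> (\<epsilon>\<^sub>2 - \<epsilon>\<^sub>1) * ybound\<^sup>2 * cmod z * ybound * (?L * cmod z)" .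
  qed
  also have "\<dots> = l * ((\<epsilon>\<^sub>2 - \<epsilon>\<^sub>1) * ybound\<^sup>2 * ybound * ?L) * (cmod z)\<^sup>2"
    using l by (simp add: power2_eq_square)
  finally show ?thesis .
qed

lemma response_coercive:
  assumes S: "subspace S" "closed S" "1 \<in> S"
    and pos: "\<And>z. \<lbrakk>z \<in> S; z \<noteq> 0\<rbrakk> \<Longrightarrow> Re (cnj z * response z) > 0"
  obtains m where "m > 0" "\<And>z. z \<in> S \<Longrightarrow> m * (cmod z)\<^sup>2 \<le> Re (cnj z * response z)"
proof -
  \<comment> \<open>The pairing is homogeneous of degree two, so its minimum over the unit sphere of
    \<open>S\<close> is the coercivity constant. The point 1 ensures that this sphere is
    nonempty.\<close>
  have "compact (S \<inter> sphere 0 1)" using S(2) by (simp add: closed_Int_compact)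
  moreover have "S \<inter> sphere 0 1 \<noteq> {}" using S(3) by auto
  moreover have "continuous_on (S \<inter> sphere 0 1) (\<lambda>z. Re (cnj z * response z))"
    by (intro continuous_intros continuous_on_subset[OF response_continuous]) auto
  ultimately obtain z0 where z0: "z0 \<in> S \<inter> sphere 0 1"
    "\<forall>z\<in>S \<inter> sphere 0 1. Re (cnj z0 * response z0) \<le> Re (cnj z * response z)"
    using continuous_attains_inf by blast
  show thesis
  proof (rule that)
    show "Re (cnj z0 * response z0) > 0" using z0(1) by (intro pos) auto
    fix z assume z: "z \<in> S"
    show "Re (cnj z0 * response z0) * (cmod z)\<^sup>2 \<le> Re (cnj z * response z)"
    proof (cases "z = 0")
      case False
      define w where "w = (1 / cmod z) *\<^sub>R z"
      have w: "w \<in> S \<inter> sphere 0 1" using subspace_scale[OF S(1) z] False by (simp add: w_def)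
      have zw: "z = complex_of_real (cmod z) * w" using False by (simp add: w_def scaleR_conv_of_real)
      have "response z = complex_of_real (cmod z) * response w"
        by (subst zw, rule response_scale) simp
      then have "cnj z * response z = complex_of_real ((cmod z)\<^sup>2) * (cnj w * response w)"
        by (subst zw) (simp add: power2_eq_square)
      then have "Re (cnj z * response z) = (cmod z)\<^sup>2 * Re (cnj w * response w)" by (simp only: Re_complex_of_real times_complex.simps Im_complex_of_real mult_zero_left diff_zero)
      moreover have "Re (cnj z0 * response z0) \<le> Re (cnj w * response w)" using z0(2) w by blast
      ultimately show ?thesis by (simp add: mult_left_mono mult.commute)
    qed simp
  qed
qed

text \<open>For each small t of either sign, the boundary defect at frequency \<omega> + i t, viewed
  as a field in \<open>z\<close>, points outward on a circle of radius \<open>r\<close> that does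
  not depend on t; hence it vanishes for some \<open>z\<close> inside.\<close>

lemma frequency_shift:
  assumes S: "subspace S" "closed S" "1 \<in> S"
    and pos: "\<And>z. \<lbrakk>z \<in> S; z \<noteq> 0\<rbrakk> \<Longrightarrow> Re (cnj z * response z) > 0"
    and inS: "\<And>t z \<eta> \<nu>. \<lbrakk>z \<in> S; \<bar>t\<bar> \<le> 1; ybound\<^sup>2 * cmod z \<le> 1; ivp_solution l (coeff t z) 0 1 \<eta> \<nu>\<rbrakk>
        \<Longrightarrow> mismatch t (\<eta> l) (\<nu> l) \<in> S"
    and \<delta>: "\<delta> > 0"
  obtains t0 where "t0 > 0" "\<And>t. \<bar>t\<bar> < t0 \<Longrightarrow> \<exists>\<epsilon>'. \<epsilon>' \<in> borel_measurable (lebesgue_on {0..l}) \<and>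
      (\<forall>x\<in>{0..l}. \<epsilon>\<^sub>1 \<le> \<epsilon>' x \<and> \<epsilon>' x \<le> \<epsilon>\<^sub>2 \<and> \<bar>\<epsilon>' x - \<epsilon> x\<bar> < \<delta>) \<and>
      (\<exists>q \<eta> \<nu>. (\<forall>x. q x = - ((\<omega> + \<i> * complex_of_real t)\<^sup>2 / (complex_of_real c)\<^sup>2) * complex_of_real (\<epsilon>' x)) \<and>
        bounded_coefficient l qbound q \<and> ivp_solution l q 0 1 \<eta> \<nu> \<and>
        \<nu> l = \<i> * (\<omega> + \<i> * complex_of_real t) * complex_of_real k * \<eta> l)"
proof -
  obtain m where m: "m > 0" "\<And>z. z \<in> S \<Longrightarrow> m * (cmod z)\<^sup>2 \<le> Re (cnj z * response z)"
    using response_coercive[OF S pos] by blast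
  define C where "C = l * ((\<epsilon>\<^sub>2 - \<epsilon>\<^sub>1) * ybound\<^sup>2 * ybound * (coeff_lip * ybound * l * ybound))"
  have C: "C \<ge> 0" unfolding C_def using l \<epsilon>12 ybound_ge1 coeff_lip_nonneg by (intro mult_nonneg_nonneg) auto
  define B where "B = (\<epsilon>\<^sub>2 - \<epsilon>\<^sub>1) * ybound\<^sup>2"
  have B: "B > 0" unfolding B_def using \<epsilon>12 ybound_ge1 by (intro mult_pos_pos) auto
  \<comment> \<open>The three bounds keep the varied cavity admissible, keep it strictly within
    \<delta> of \<epsilon>, and keep the quadratic error below the coercivity constant.\<close>
  define r where "r = min (1 / ybound\<^sup>2) (min (\<delta> / (2 * B)) (m / (2 * (C + 1))))"
  have r: "r > 0" unfolding r_def using ybound_ge1 \<delta> B m(1) C by simp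
  have r1: "ybound\<^sup>2 * r \<le> 1"
  proof -
    have "ybound\<^sup>2 * r \<le> ybound\<^sup>2 * (1 / ybound\<^sup>2)" by (intro mult_left_mono) (auto simp: r_def)
    then show ?thesis using ybound_ge1 by simp
  qed
  have r2: "B * r < \<delta>"
  proof -
    have "B * r \<le> B * (\<delta> / (2 * B))" using B by (intro mult_left_mono) (auto simp: r_def)
    then show ?thesis using B \<delta> by simp
  qed
  have r3: "C * r < m"
  proof -
    have "C * r \<le> (C + 1) * r" using r by simp
    also have "\<dots> \<le> (C + 1) * (m / (2 * (C + 1)))" using C by (intro mult_left_mono) (auto simp: r_def)
    also have "\<dots> = m / 2" using C by (simp add: field_simps add_nonneg_eq_0_iff)
    also have "\<dots> < m" using m(1) by simp
    finally show ?thesis .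
  qed
  have yz: "ybound\<^sup>2 * cmod z \<le> 1" if "cmod z \<le> r" for z
    using mult_left_mono[OF that, of "ybound\<^sup>2"] r1 by simp
  \<comment> \<open>The margin by which the response outweighs the quadratic error on the circle;
    \<open>t0\<close> is the range of shifts whose effect
    \<open>r * mismatch_lip * \<bar>t\<bar>\<close> stays inside it.\<close>
  define p where "p = (m - C * r) * r\<^sup>2"
  have p: "p > 0" using r3 r by (simp add: p_def)
  define t0 where "t0 = min 1 (p / (r * mismatch_lip + 1))"
  have den: "r * mismatch_lip + 1 > 0" using r mismatch_lip_nonneg by (intro add_nonneg_pos mult_nonneg_nonneg) auto
  \<comment> \<open>One solution is selected for each pair of parameters. Continuity of the
    resulting field comes from \<open>mismatch_diff\<close>, which compares arbitrary
    solutions.\<close>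
  have "\<forall>t z. \<exists>\<eta>\<nu>. \<bar>t\<bar> \<le> 1 \<and> ybound\<^sup>2 * cmod z \<le> 1 \<longrightarrow> ivp_solution l (coeff t z) 0 1 (fst \<eta>\<nu>) (snd \<eta>\<nu>)"
  proof (intro allI)
    fix t z
    show "\<exists>\<eta>\<nu>. \<bar>t\<bar> \<le> 1 \<and> ybound\<^sup>2 * cmod z \<le> 1 \<longrightarrow> ivp_solution l (coeff t z) 0 1 (fst \<eta>\<nu>) (snd \<eta>\<nu>)"
    proof (cases "\<bar>t\<bar> \<le> 1 \<and> ybound\<^sup>2 * cmod z \<le> 1")
      case True
      obtain a b where "ivp_solution l (coeff t z) 0 1 a b"
        using ivp_solution_exists[OF coeff_bounded[of t z]] True l by (metis less_imp_le)
      then show ?thesis by (intro exI[of _ "(a, b)"]) simp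
    qed blast
  qed
  then obtain X where X: "\<And>t z. \<lbrakk>\<bar>t\<bar> \<le> 1; ybound\<^sup>2 * cmod z \<le> 1\<rbrakk> \<Longrightarrow> ivp_solution l (coeff t z) 0 1 (fst (X t z)) (snd (X t z))"
    by metis
  define G where "G t z = mismatch t (fst (X t z) l) (snd (X t z) l)" for t z
  have GL: "norm (G t z - G t' z') \<le> mismatch_lip * (\<bar>t - t'\<bar> + cmod (z - z'))"
    if "\<bar>t\<bar> \<le> 1" "\<bar>t'\<bar> \<le> 1" "cmod z \<le> r" "cmod z' \<le> r" for t t' z z'
    unfolding G_def by (intro mismatch_diff X that yz)
  show thesis
  proof (rule that)
    show "t0 > 0" using p den by (simp add: t0_def)
    fix t assume t: "\<bar>t\<bar> < t0"
    then have t1: "\<bar>t\<bar> \<le> 1" and "\<bar>t\<bar> < p / (r * mismatch_lip + 1)" by (auto simp: t0_def)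
    then have t2: "\<bar>t\<bar> * (r * mismatch_lip + 1) < p" using den by (simp add: pos_less_divide_eq)
    obtain z where z: "z \<in> S" "norm z \<le> r" "G t z = 0"
    proof (rule zero_of_inward_field[OF S(1,2) r])
      have "mismatch_lip-lipschitz_on (S \<inter> cball 0 r) (G t)"
        using GL[OF t1 t1] mismatch_lip_nonneg by (intro lipschitz_onI) (auto simp: dist_norm)
      then show "continuous_on (S \<inter> cball 0 r) (G t)" by (rule lipschitz_on_continuous_on)
      show "G t z \<in> S" if "z \<in> S \<inter> cball 0 r" for z
        unfolding G_def by (rule inS[OF _ t1 _ X[OF t1]]) (use that yz[of z] in auto)
      fix z assume z: "z \<in> S" "norm z = r"
      have "norm (G 0 z - response z) \<le> C * (cmod z)\<^sup>2"
        unfolding G_def C_def by (rule mismatch_response[OF X]) (use z yz[of z] in auto)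
      then have 1: "norm (G 0 z - response z) \<le> C * r\<^sup>2" using z by simp
      have "norm (G t z - G 0 z) \<le> mismatch_lip * (\<bar>t - 0\<bar> + cmod (z - z))"
        by (rule GL) (use t1 z in auto)
      then have 2: "norm (G t z - G 0 z) \<le> mismatch_lip * \<bar>t\<bar>" by simp
      have "norm (G t z - response z) \<le> mismatch_lip * \<bar>t\<bar> + C * r\<^sup>2"
        using norm_triangle_le[OF add_mono[OF 2 1]] by simp
      then have "norm (cnj z * (G t z - response z)) \<le> r * (mismatch_lip * \<bar>t\<bar> + C * r\<^sup>2)"
        unfolding norm_mult complex_mod_cnj z(2) using r by (intro mult_left_mono) auto
      then have "\<bar>Re (cnj z * (G t z - response z))\<bar> \<le> r * (mismatch_lip * \<bar>t\<bar> + C * r\<^sup>2)"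
        using abs_Re_le_cmod order_trans by blast
      moreover have "Re (cnj z * G t z) = Re (cnj z * response z) + Re (cnj z * (G t z - response z))"
        by (simp only: right_diff_distrib minus_complex.simps)
      moreover have "m * r\<^sup>2 \<le> Re (cnj z * response z)" using m(2)[OF z(1)] z(2) by simp
      moreover have "r * (mismatch_lip * \<bar>t\<bar> + C * r\<^sup>2) < m * r\<^sup>2"
      proof -
        have "r * mismatch_lip * \<bar>t\<bar> \<le> \<bar>t\<bar> * (r * mismatch_lip + 1)" by (simp add: algebra_simps)
        then show ?thesis using t2 by (simp add: p_def algebra_simps)
      qed
      ultimately show "Re (cnj z * G t z) > 0" by linarith
    qed
    note yzz = yz[OF z(2)]
    show "\<exists>\<epsilon>'. \<epsilon>' \<in> borel_measurable (lebesgue_on {0..l}) \<and>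
      (\<forall>x\<in>{0..l}. \<epsilon>\<^sub>1 \<le> \<epsilon>' x \<and> \<epsilon>' x \<le> \<epsilon>\<^sub>2 \<and> \<bar>\<epsilon>' x - \<epsilon> x\<bar> < \<delta>) \<and>
      (\<exists>q \<eta> \<nu>. (\<forall>x. q x = - ((\<omega> + \<i> * complex_of_real t)\<^sup>2 / (complex_of_real c)\<^sup>2) * complex_of_real (\<epsilon>' x)) \<and>
        bounded_coefficient l qbound q \<and> ivp_solution l q 0 1 \<eta> \<nu> \<and>
        \<nu> l = \<i> * (\<omega> + \<i> * complex_of_real t) * complex_of_real k * \<eta> l)"
    proof (rule exI[of _ "\<lambda>x. \<epsilon> x + variation z x"], intro conjI ballI)
      show "(\<lambda>x. \<epsilon> x + variation z x) \<in> borel_measurable (lebesgue_on {0..l})"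
        by (intro borel_measurable_add \<epsilon>_meas variation_measurable)
      fix x assume x: "x \<in> {0..l}"
      show "\<epsilon>\<^sub>1 \<le> \<epsilon> x + variation z x" "\<epsilon> x + variation z x \<le> \<epsilon>\<^sub>2" by (rule variation_bounds[OF x yzz])+
      have "\<bar>variation z x\<bar> \<le> B * cmod z" using variation_abs_le[OF x, of z] by (simp add: B_def)
      also have "\<dots> \<le> B * r" using z(2) B by (intro mult_left_mono) auto
      finally show "\<bar>\<epsilon> x + variation z x - \<epsilon> x\<bar> < \<delta>" using r2 by simp
    next
      have "snd (X t z) l = \<i> * (\<omega> + \<i> * complex_of_real t) * complex_of_real k * fst (X t z) l"
        using z(3) unfolding G_def mismatch_zero_iff .
      moreover have "\<forall>x. coeff t z x = - ((\<omega> + \<i> * complex_of_real t)\<^sup>2 / (complex_of_real c)\<^sup>2) * complex_of_real (\<epsilon> x + variation z x)"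
        by (rule allI, subst coeff_def, rule refl)
      ultimately show "\<exists>q \<eta> \<nu>. (\<forall>x. q x = - ((\<omega> + \<i> * complex_of_real t)\<^sup>2 / (complex_of_real c)\<^sup>2) * complex_of_real (\<epsilon> x + variation z x)) \<and>
        bounded_coefficient l qbound q \<and> ivp_solution l q 0 1 \<eta> \<nu> \<and>
        \<nu> l = \<i> * (\<omega> + \<i> * complex_of_real t) * complex_of_real k * \<eta> l"
        using coeff_bounded[OF t1 yzz] X[OF t1 yzz] by blast
    qed
  qed
qed

text \<open>Rotating \<open>y\<close> by a square root of \<open>\<i> * cnj u\<close> turns \<open>intensity u\<close> into \<open>Im (E\<^sup>2)\<close>.\<close>
lemma extremal_direction:
  assumes u: "u \<noteq> 0" and le: "Re (cnj u * response u) \<le> 0"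
    and null: "negligible {s \<in> {0<..<l}. intensity u s = 0}"
  obtains \<kappa> where "\<kappa> \<noteq> 0"
    "AE s in lebesgue_on {0<..<l}. \<epsilon> s = \<epsilon>\<^sub>1 + (\<epsilon>\<^sub>2 - \<epsilon>\<^sub>1) * chi_plus ((\<kappa> * y s)\<^sup>2)"
proof -
  \<comment> \<open>The density of \<open>Re (cnj u * response u)\<close>. Since it is a sum of two
    nonnegative terms, a nonpositive integral makes both vanish almost everywhere.\<close>
  define f where "f s = variation u s * intensity u s" for s
  have split: "f s = (\<epsilon>\<^sub>2 - \<epsilon> s) * (max 0 (intensity u s))\<^sup>2 + (\<epsilon> s - \<epsilon>\<^sub>1) * (max 0 (- intensity u s))\<^sup>2" for s
    by (cases "intensity u s \<ge> 0") (auto simp: f_def variation_def power2_eq_square max_def)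
  have f0: "0 \<le> f s" if "s \<in> {0..l}" for s
    unfolding split using \<epsilon>_bounds[OF that] by (intro add_nonneg_nonneg mult_nonneg_nonneg) auto
  have fb: "f s \<le> ((\<epsilon>\<^sub>2 - \<epsilon>\<^sub>1) * ybound\<^sup>2 * cmod u) * (ybound\<^sup>2 * cmod u)" if s: "s \<in> {0..l}" for s
  proof -
    have "f s \<le> \<bar>variation u s\<bar> * \<bar>intensity u s\<bar>" unfolding f_def abs_mult[symmetric] by (rule abs_ge_self)
    also have "\<dots> \<le> ((\<epsilon>\<^sub>2 - \<epsilon>\<^sub>1) * ybound\<^sup>2 * cmod u) * (ybound\<^sup>2 * cmod u)"
      using variation_abs_le[OF s, of u] intensity_diff[OF s, of u 0] \<epsilon>12
      by (intro mult_mono) (auto simp: intensity_def)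
    finally show ?thesis .
  qed
  have "bounded_linear (\<lambda>w. Re (cnj u * w))"
    by (intro bounded_linear_compose[OF bounded_linear_Re] bounded_linear_mult_right)
  from has_integral_linear[OF integrable_integral[OF response_integrable] this]
  have "((\<lambda>s. Re (cnj u * (complex_of_real (variation u s) * (y s)\<^sup>2))) has_integral Re (cnj u * response u)) {0..l}"
    by (simp only: o_def response_def)
  moreover have "Re (cnj u * (complex_of_real (variation u s) * (y s)\<^sup>2)) = f s" for s
    unfolding f_def intensity_def mult.left_commute[of "cnj u"] by simp
  ultimately have "(f has_integral Re (cnj u * response u)) {0..l}" by (simp only:)
  then have int: "integral {0..l} f \<le> 0" using le by (simp add: integral_unique)
  have "f \<in> borel_measurable (lebesgue_on {0..l})"
    unfolding f_def by (intro borel_measurable_times variation_measurable intensity_measurable)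
  then have N: "negligible {x \<in> {0..l}. f x \<noteq> 0}"
    by (rule nonneg_integral_zero_negligible[OF _ conjI int]) (use f0 fb in blast)+
  define \<kappa> where "\<kappa> = csqrt (\<i> * cnj u)"
  show thesis
  proof (rule that[of \<kappa>])
    show "\<kappa> \<noteq> 0" using u by (simp add: \<kappa>_def)
    show "AE s in lebesgue_on {0<..<l}. \<epsilon> s = \<epsilon>\<^sub>1 + (\<epsilon>\<^sub>2 - \<epsilon>\<^sub>1) * chi_plus ((\<kappa> * y s)\<^sup>2)"
    \<comment> \<open>Where the intensity is zero the vanishing density leaves \<epsilon>
      undetermined, so that null set is removed together with the exceptional set of
      \<open>f\<close>.\<close>
    proof (rule AE_lebesgue_onI[OF negligible_Un[OF N null]])
      fix s assume s: "s \<in> {0<..<l} - ({x \<in> {0..l}. f x \<noteq> 0} \<union> {s \<in> {0<..<l}. intensity u s = 0})"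
      then have fs: "f s = 0" and p: "intensity u s \<noteq> 0" by auto
      have "Im ((\<kappa> * y s)\<^sup>2) = intensity u s"
        by (simp add: \<kappa>_def power_mult_distrib intensity_def mult.assoc)
      then have chi: "chi_plus ((\<kappa> * y s)\<^sup>2) = (if intensity u s > 0 then 1 else 0)"
        by (simp add: chi_plus_def)
      show "\<epsilon> s = \<epsilon>\<^sub>1 + (\<epsilon>\<^sub>2 - \<epsilon>\<^sub>1) * chi_plus ((\<kappa> * y s)\<^sup>2)"
      proof (cases "intensity u s > 0")
        case True
        then show ?thesis using fs unfolding split chi by simp
      next
        case False
        then show ?thesis using fs p unfolding split chi by simp
      qed
    qed simp
  qed
qed

end

section \<open>From absolutely continuous solutions of the boundary value problem to the normalised
  mode\<close>

lemma abs_continuous_on_subinterval: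
  assumes "abs_continuous_on a b F" "a \<le> a'" "b' \<le> b" shows "abs_continuous_on a' b' F"
  unfolding abs_continuous_on_def
proof (intro allI impI)
  fix e :: real assume e: "e > 0"
  obtain d where d: "d > 0" "\<And>(n::nat) p q. \<lbrakk>\<forall>i<n. a \<le> p i \<and> p i \<le> q i \<and> q i \<le> b;
      disjoint_family_on (\<lambda>i. {p i<..<q i}) {..<n}; (\<Sum>i<n. q i - p i) < d\<rbrakk> \<Longrightarrow> (\<Sum>i<n. norm (F (q i) - F (p i))) < e"
    using assms(1)[unfolded abs_continuous_on_def, rule_format, OF e] by blast
  show "\<exists>d>0. \<forall>(n::nat) p q. (\<forall>i<n. a' \<le> p i \<and> p i \<le> q i \<and> q i \<le> b') \<and>
      disjoint_family_on (\<lambda>i. {p i<..<q i}) {..<n} \<and> (\<Sum>i<n. q i - p i) < d \<longrightarrow> (\<Sum>i<n. norm (F (q i) - F (p i))) < e"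
  proof (intro exI[of _ d] conjI d(1) allI impI)
    fix n :: nat and p q :: "nat \<Rightarrow> real"
    assume "(\<forall>i<n. a' \<le> p i \<and> p i \<le> q i \<and> q i \<le> b') \<and> disjoint_family_on (\<lambda>i. {p i<..<q i}) {..<n} \<and> (\<Sum>i<n. q i - p i) < d"
    then have pq: "\<forall>i<n. a' \<le> p i \<and> p i \<le> q i \<and> q i \<le> b'"
      and 2: "disjoint_family_on (\<lambda>i. {p i<..<q i}) {..<n}" "(\<Sum>i<n. q i - p i) < d" by blast+
    have "\<forall>i<n. a \<le> p i \<and> p i \<le> q i \<and> q i \<le> b" using pq assms(2,3) by (meson order_trans)
    then show "(\<Sum>i<n. norm (F (q i) - F (p i))) < e" by (rule d(2)[OF _ 2])
  qed
qed

lemma abs_continuous_on_imp_continuous_on: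
  assumes ac: "abs_continuous_on a b F" shows "continuous_on {a..b} F"
  unfolding continuous_on_iff
proof (intro ballI allI impI)
  fix x e :: real assume x: "x \<in> {a..b}" and e: "e > 0"
  obtain d where d: "d > 0" "\<And>(n::nat) p q. \<lbrakk>\<forall>i<n. a \<le> p i \<and> p i \<le> q i \<and> q i \<le> b;
      disjoint_family_on (\<lambda>i. {p i<..<q i}) {..<n}; (\<Sum>i<n. q i - p i) < d\<rbrakk> \<Longrightarrow> (\<Sum>i<n. norm (F (q i) - F (p i))) < e"
    using ac[unfolded abs_continuous_on_def, rule_format, OF e] by blast
  have one: "norm (F t - F s) < e" if "a \<le> s" "s \<le> t" "t \<le> b" "t - s < d" for s t
    using d(2)[of 1 "\<lambda>_. s" "\<lambda>_. t"] that by (simp add: disjoint_family_on_def lessThan_Suc)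
  show "\<exists>d>0. \<forall>x'\<in>{a..b}. dist x' x < d \<longrightarrow> dist (F x') (F x) < e"
  proof (intro exI[of _ d] conjI d(1) ballI impI)
    fix x' assume x': "x' \<in> {a..b}" "dist x' x < d"
    show "dist (F x') (F x) < e"
    proof (cases "x' \<le> x")
      case True
      then show ?thesis using one[of x' x] x x' by (simp add: dist_norm norm_minus_commute)
    next
      case False
      then show ?thesis using one[of x x'] x x' by (simp add: dist_norm)
    qed
  qed
qed

lemma ivp_solution_scale:
  assumes "ivp_solution l q a b y v"
  shows "ivp_solution l q (r * a) (r * b) (\<lambda>s. r * y s) (\<lambda>s. r * v s)"
  unfolding ivp_solution_def
proof (intro conjI ballI)
  show "continuous_on {0..l} (\<lambda>s. r * y s)" "continuous_on {0..l} (\<lambda>s. r * v s)"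
    using assms by (auto simp: ivp_solution_def intro: continuous_on_mult_left)
  fix s assume s: "s \<in> {0..l}"
  have y: "y s = a + integral {0..s} v" and v: "v s = b + integral {0..s} (\<lambda>x. q x * y x)"
    using assms s by (auto simp: ivp_solution_def)
  show "r * y s = r * a + integral {0..s} (\<lambda>s. r * v s)"
    unfolding y distrib_left by (simp only: Henstock_Kurzweil_Integration.integral_mult_right)
  have "integral {0..s} (\<lambda>x. q x * (r * y x)) = integral {0..s} (\<lambda>x. r * (q x * y x))"
    by (simp only: mult.left_commute)
  also have "\<dots> = r * integral {0..s} (\<lambda>x. q x * y x)" by (rule Henstock_Kurzweil_Integration.integral_mult_right)
  finally show "r * v s = r * b + integral {0..s} (\<lambda>x. q x * (r * y x))" unfolding v distrib_left by (simp only:)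
qed

text \<open>The derivative of E' is known only almost everywhere; absolute continuity of E' is what
  turns it into the integral equation.\<close>

lemma bvp_solution_ivp:
  assumes l: "0 < l" and bvp: "bvp_solution l c \<epsilon>inf \<omega> F E"
    and q: "bounded_coefficient l Q q" and F: "AE s in lebesgue_on {0<..<l}. F s = q s * E s"
  obtains b E' where "ivp_solution l q 0 b E E'" "E' l = \<i> * \<omega> * complex_of_real (sqrt \<epsilon>inf / c) * E l"
proof -
  obtain E' where E': "abs_continuous_on 0 l E'" "\<And>s. s \<in> {0..l} \<Longrightarrow> (E has_vector_derivative E' s) (at s within {0..l})"
    "AE s in lebesgue_on {0<..<l}. (E' has_vector_derivative F s) (at s)" "E 0 = 0"
    "\<i> * \<omega> * complex_of_real (sqrt \<epsilon>inf / c) * E l = E' l"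
    using bvp unfolding bvp_solution_def by blast
  have S: "{0<..<l} \<in> sets lebesgue" by simp
  have "AE s in lebesgue_on {0<..<l}. (E' has_vector_derivative q s * E s) (at s)"
    using E'(3) F by eventually_elim simp
  then obtain N where N: "negligible N" "\<And>s. s \<in> {0<..<l} - N \<Longrightarrow> (E' has_vector_derivative q s * E s) (at s)"
    by (rule AE_lebesgue_onE[OF _ S]) blast
  have "ivp_solution l q 0 (E' 0) E E'"
    unfolding ivp_solution_def
  proof (intro conjI ballI)
    show "continuous_on {0..l} E"
      using E'(2) by (meson continuous_on_eq_continuous_within has_vector_derivative_continuous)
    show "continuous_on {0..l} E'" by (rule abs_continuous_on_imp_continuous_on[OF E'(1)])
    fix s assume s: "s \<in> {0..l}"
    have "(E' has_integral (E s - E 0)) {0..s}"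
    proof (rule fundamental_theorem_of_calculus)
      fix x assume "x \<in> {0..s}"
      then show "(E has_vector_derivative E' x) (at x within {0..s})"
        using s by (intro has_vector_derivative_within_subset[OF E'(2)]) auto
    qed (use s in auto)
    then show "E s = 0 + integral {0..s} E'" using E'(4) by (simp add: integral_unique)
    have "((\<lambda>x. q x * E x) has_integral (E' s - E' 0)) {0..s}"
    proof (rule abs_continuous_has_integral)
      show "abs_continuous_on 0 s E'" by (rule abs_continuous_on_subinterval[OF E'(1)]) (use s in auto)
      show "negligible (N \<union> {0, l})" by (rule negligible_Un[OF N(1)]) simp
      show "(E' has_vector_derivative q x * E x) (at x within {0..s})" if "x \<in> {0..s} - (N \<union> {0, l})" for x
        by (rule has_vector_derivative_at_within[OF N(2)]) (use that s in auto)
    qed (use s in auto)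
    then show "E' s = E' 0 + integral {0..s} (\<lambda>x. q x * E x)" by (simp add: integral_unique)
  qed
  then show thesis using that E'(5) by metis
qed

lemma qn_eigenvalue_ivp:
  assumes l: "0 < l" and qn: "qn_eigenvalue l c \<epsilon>inf \<epsilon> \<omega>" and q: "bounded_coefficient l Q q"
    and ae: "AE s in lebesgue_on {0<..<l}. - (\<omega>\<^sup>2 / (complex_of_real c)\<^sup>2) * complex_of_real (\<epsilon> s) = q s"
  obtains y v where "ivp_solution l q 0 1 y v" "v l = \<i> * \<omega> * complex_of_real (sqrt \<epsilon>inf / c) * y l"
proof -
  obtain E where E: "bvp_solution l c \<epsilon>inf \<omega> (\<lambda>s. - (\<omega>\<^sup>2 / (complex_of_real c)\<^sup>2) * complex_of_real (\<epsilon> s) * E s) E"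
    "\<exists>s\<in>{0..l}. E s \<noteq> 0"
    using qn unfolding qn_eigenvalue_def by blast
  have "AE s in lebesgue_on {0<..<l}. - (\<omega>\<^sup>2 / (complex_of_real c)\<^sup>2) * complex_of_real (\<epsilon> s) * E s = q s * E s"
    using ae by eventually_elim simp
  then obtain b E' where solE: "ivp_solution l q 0 b E E'" "E' l = \<i> * \<omega> * complex_of_real (sqrt \<epsilon>inf / c) * E l"
    using bvp_solution_ivp[OF l E(1) q] by metis
  obtain y v where sol: "ivp_solution l q 0 1 y v"
    using ivp_solution_exists[OF q] l by (metis less_imp_le)
  have sc: "ivp_solution l q 0 b (\<lambda>s. b * y s) (\<lambda>s. b * v s)"
    using ivp_solution_scale[OF sol, of b] by simp
  note eq = ivp_solution_unique[OF solE(1) sc q]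
  \<comment> \<open>By uniqueness \<open>E\<close> is \<open>b\<close> times the normalised
    solution. A nontrivial \<open>E\<close> forces \<open>b\<close> to be nonzero, and the
    homogeneous boundary condition passes to \<open>y\<close>.\<close>
  have "b \<noteq> 0" using E(2) eq(1) by fastforce
  moreover have "b * v l = \<i> * \<omega> * complex_of_real (sqrt \<epsilon>inf / c) * (b * y l)"
    using solE(2) eq[of l] l by (metis atLeastAtMost_iff less_imp_le order_refl)
  then have "b * v l = b * (\<i> * \<omega> * complex_of_real (sqrt \<epsilon>inf / c) * y l)" by (simp only: mult_ac)
  ultimately have "v l = \<i> * \<omega> * complex_of_real (sqrt \<epsilon>inf / c) * y l"
    by (metis mult_left_cancel)
  with sol show thesis by (rule that)
qed

lemma subspace_complex_Reals: "subspace (\<real> :: complex set)"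
  by (auto simp: subspace_def scaleR_conv_of_real)

section \<open>Location of the frequency and the bang-bang profile\<close>

context cavity_mode begin

text \<open>For real \<omega> the mode is real, so the boundary condition equates a real and a
  purely imaginary number; both vanish, and only \<open>k\<close> can be responsible.\<close>

lemma mode_nonreal: "Im \<omega> = 0 \<Longrightarrow> k = 0"
proof -
  assume "Im \<omega> = 0"
  then have \<omega>: "\<omega> \<in> \<real>" by (simp add: complex_is_Real_iff)
  have lI: "l \<in> {0..l}" using l by simp
  have "coeff 0 0 x \<in> \<real>" for x
    unfolding coeff_0 using \<omega> by (intro Reals_mult Reals_minus Reals_divide Reals_power Reals_of_real)
  from ivp_solution_real[OF mode_solution mode_bounded_coefficient _ _ this lI]
  have "y l \<in> \<real>" "v l \<in> \<real>" by auto
  then have im: "Im (y l) = 0" "Im (v l) = 0" by (simp_all add: complex_is_Real_iff)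
  then have "Re \<omega> * k * Re (y l) = 0" using bc \<open>Im \<omega> = 0\<close> by (simp add: complex_eq_iff)
  moreover have "Re \<omega> \<noteq> 0" "Re (y l) \<noteq> 0"
    using \<omega>_nonzero y_final_nonzero \<open>Im \<omega> = 0\<close> im by (auto simp: complex_eq_iff)
  ultimately show "k = 0" by simp
qed

text \<open>For imaginary \<omega> all quantities entering the defect are real: \<omega>^2, its
  shifted version, and i times the shifted frequency in the boundary condition.\<close>

lemma imaginary_mode_mismatch_real:
  assumes \<omega>: "Re \<omega> = 0" and t: "\<bar>t\<bar> \<le> 1" and z: "ybound\<^sup>2 * cmod z \<le> 1"
    and s: "ivp_solution l (coeff t z) 0 1 \<eta> \<nu>"
  shows "mismatch t (\<eta> l) (\<nu> l) \<in> \<real>"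
proof -
  have lI: "l \<in> {0..l}" using l by simp
  have W: "\<i> * (\<omega> + \<i> * complex_of_real t) \<in> \<real>" "(\<omega> + \<i> * complex_of_real t)\<^sup>2 \<in> \<real>" "\<omega>\<^sup>2 \<in> \<real>" for t
    using \<omega> by (simp_all add: complex_is_Real_iff power2_eq_square)
  have cr: "coeff t z x \<in> \<real>" for t z x
    unfolding coeff_def by (intro Reals_mult Reals_minus Reals_divide Reals_power[of "complex_of_real _"] Reals_of_real W)
  have "y l \<in> \<real>" by (rule ivp_solution_real(1)[OF mode_solution mode_bounded_coefficient _ _ cr lI]) auto
  moreover have "\<eta> l \<in> \<real>" "\<nu> l \<in> \<real>"
    using ivp_solution_real[OF s coeff_bounded[OF t z] _ _ cr lI] by auto
  ultimately show ?thesis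
    unfolding mismatch_def
    by (intro Reals_mult Reals_minus Reals_divide Reals_diff Reals_power[of "complex_of_real _"] Reals_of_real W)
qed

text \<open>Here y'' is a positive multiple of y, so the real mode has no zero inside the cavity and
  cnj u * y^2 is real and nonzero.\<close>

lemma imaginary_mode_intensity_nonzero:
  assumes \<omega>: "Re \<omega> = 0" and u: "u \<in> \<real>" "u \<noteq> 0" and s: "s \<in> {0<..<l}"
  shows "intensity u s \<noteq> 0"
proof -
  define \<mu> where "\<mu> = - (\<omega>\<^sup>2 / (complex_of_real c)\<^sup>2)"
  have \<mu>: "\<mu> = complex_of_real ((Im \<omega>)\<^sup>2 / c\<^sup>2)"
    using \<omega> by (simp add: \<mu>_def complex_eq_iff power2_eq_square)
  have "Im \<omega> \<noteq> 0" using \<omega>_nonzero \<omega> by (auto simp: complex_eq_iff)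
  then have "Re \<mu> > 0" "\<mu> \<in> \<real>" using c unfolding \<mu> by simp_all
  have sI: "s \<in> {0..l}" using s by simp
  have y0: "y s \<noteq> 0"
  proof (rule ivp_solution_rotation(2)[OF sol[folded \<mu>_def] mode_bounded_coefficient[unfolded coeff_0, folded \<mu>_def]])
    show "1 \<le> \<epsilon> x" if "x \<in> {0..l}" for x using \<epsilon>_bounds[OF that] \<epsilon>12 by simp
  qed (use s \<open>Re \<mu> > 0\<close> \<open>\<mu> \<in> \<real>\<close> in auto)
  have "coeff 0 0 x \<in> \<real>" for x
    unfolding coeff_0 \<mu>_def[symmetric] by (intro Reals_mult \<open>\<mu> \<in> \<real>\<close> Reals_of_real)
  then have "y s \<in> \<real>"
    by (intro ivp_solution_real(1)[OF mode_solution mode_bounded_coefficient _ _ _ sI]) auto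
  then have "cnj u * (y s)\<^sup>2 \<in> \<real>" "cnj u * (y s)\<^sup>2 \<noteq> 0"
    using u y0 by (auto simp: Reals_cnj_iff[THEN iffD1])
  then show ?thesis unfolding intensity_def by (auto simp: complex_is_Real_iff complex_eq_iff)
qed

lemma rotating_mode_intensity_negligible:
  assumes \<omega>: "Im (\<omega>\<^sup>2) \<noteq> 0" and u: "u \<noteq> 0"
  shows "negligible {s \<in> {0<..<l}. intensity u s = 0}"
proof -
  define \<mu> where "\<mu> = - (\<omega>\<^sup>2 / (complex_of_real c)\<^sup>2)"
  have "\<mu> = - (complex_of_real (1 / c\<^sup>2) * \<omega>\<^sup>2)" by (simp add: \<mu>_def)
  then have "Im \<mu> = - (1 / c\<^sup>2 * Im (\<omega>\<^sup>2))" by (simp only: uminus_complex.simps times_complex.simps Re_complex_of_real Im_complex_of_real mult_zero_left add_0_right)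
  then have "Im \<mu> \<noteq> 0" using \<omega> c by simp
  show ?thesis
    unfolding intensity_def
  proof (rule ivp_solution_negligible_rotated_zeros[OF sol[folded \<mu>_def] mode_bounded_coefficient[unfolded coeff_0, folded \<mu>_def] _ \<open>Im \<mu> \<noteq> 0\<close>])
    show "1 \<le> \<epsilon> x" if "x \<in> {0..l}" for x using \<epsilon>_bounds[OF that] \<epsilon>12 by simp
  qed (use u in simp)
qed

text \<open>The sign \<sigma> records the side to which the imaginary part cannot move, so that both
  kinds of extremizer are handled at once. Extremality is phrased through normalised solutions, the
  form in which the shifted modes are constructed.\<close>

lemma extremal_profile:
  assumes k: "k \<noteq> 0" and \<delta>: "\<delta> > 0" and \<sigma>: "\<bar>\<sigma>\<bar> = 1"
    and ext: "\<And>\<epsilon>' q \<eta> \<nu> t. \<lbrakk>\<epsilon>' \<in> borel_measurable (lebesgue_on {0..l});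
        \<And>x. x \<in> {0..l} \<Longrightarrow> \<epsilon>\<^sub>1 \<le> \<epsilon>' x \<and> \<epsilon>' x \<le> \<epsilon>\<^sub>2 \<and> \<bar>\<epsilon>' x - \<epsilon> x\<bar> < \<delta>;
        \<And>x. q x = - ((\<omega> + \<i> * complex_of_real t)\<^sup>2 / (complex_of_real c)\<^sup>2) * complex_of_real (\<epsilon>' x);
        bounded_coefficient l qbound q; ivp_solution l q 0 1 \<eta> \<nu>;
        \<nu> l = \<i> * (\<omega> + \<i> * complex_of_real t) * complex_of_real k * \<eta> l; \<bar>t\<bar> < \<delta>\<rbrakk> \<Longrightarrow> \<sigma> * t \<le> 0"
  obtains \<kappa> where "\<kappa> \<noteq> 0"
    "AE s in lebesgue_on {0<..<l}. \<epsilon> s = \<epsilon>\<^sub>1 + (\<epsilon>\<^sub>2 - \<epsilon>\<^sub>1) * chi_plus ((\<kappa> * y s)\<^sup>2)"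
proof -
  have degenerate: "\<exists>u\<in>S. u \<noteq> 0 \<and> Re (cnj u * response u) \<le> 0"
    if S: "subspace S" "closed S" "1 \<in> S"
      and inS: "\<And>t z \<eta> \<nu>. \<lbrakk>z \<in> S; \<bar>t\<bar> \<le> 1; ybound\<^sup>2 * cmod z \<le> 1; ivp_solution l (coeff t z) 0 1 \<eta> \<nu>\<rbrakk>
        \<Longrightarrow> mismatch t (\<eta> l) (\<nu> l) \<in> S" for S
  proof (rule ccontr)
    assume "\<not> ?thesis"
    then have pos: "Re (cnj z * response z) > 0" if "z \<in> S" "z \<noteq> 0" for z
      using that by (meson not_le)
    obtain t0 where t0: "t0 > 0" "\<And>t. \<bar>t\<bar> < t0 \<Longrightarrow> \<exists>\<epsilon>'. \<epsilon>' \<in> borel_measurable (lebesgue_on {0..l}) \<and>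
      (\<forall>x\<in>{0..l}. \<epsilon>\<^sub>1 \<le> \<epsilon>' x \<and> \<epsilon>' x \<le> \<epsilon>\<^sub>2 \<and> \<bar>\<epsilon>' x - \<epsilon> x\<bar> < \<delta>) \<and>
      (\<exists>q \<eta> \<nu>. (\<forall>x. q x = - ((\<omega> + \<i> * complex_of_real t)\<^sup>2 / (complex_of_real c)\<^sup>2) * complex_of_real (\<epsilon>' x)) \<and>
        bounded_coefficient l qbound q \<and> ivp_solution l q 0 1 \<eta> \<nu> \<and>
        \<nu> l = \<i> * (\<omega> + \<i> * complex_of_real t) * complex_of_real k * \<eta> l)"
    proof (rule frequency_shift[where S = S and \<delta> = \<delta>])
      fix t z \<eta> \<nu>
      assume "z \<in> S" "\<bar>t\<bar> \<le> 1" "ybound\<^sup>2 * cmod z \<le> 1" "ivp_solution l (coeff t z) 0 1 \<eta> \<nu>"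
      then show "mismatch t (\<eta> l) (\<nu> l) \<in> S" by (rule inS)
    qed (use S pos \<delta> in blast)+
    \<comment> \<open>A shift to the forbidden side, small enough for the construction and for the
      neighbourhood of extremality.\<close>
    define t where "t = \<sigma> * (min t0 \<delta> / 2)"
    have at: "\<bar>t\<bar> = min t0 \<delta> / 2" using \<sigma> t0(1) \<delta> by (simp add: t_def abs_mult)
    have t: "\<bar>t\<bar> < t0" "\<bar>t\<bar> < \<delta>" unfolding at using t0(1) \<delta> by (auto simp: min_def)
    have "\<sigma> * \<sigma> = 1" using \<sigma> by (metis abs_mult_self_eq mult_1)
    then have "\<sigma> * t > 0" using t0(1) \<delta> unfolding t_def mult.assoc[symmetric] by simp
    moreover have "\<sigma> * t \<le> 0" using t0(2)[OF t(1)] ext[OF _ _ _ _ _ _ t(2)] by blast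
    ultimately show False by simp
  qed
  show thesis
  proof (cases "Im (\<omega>\<^sup>2) = 0")
    case False
    obtain u where u: "u \<noteq> 0" "Re (cnj u * response u) \<le> 0"
      using degenerate[of UNIV] by auto
    show thesis
      by (rule extremal_direction[OF u rotating_mode_intensity_negligible[OF False u(1)]]) (rule that)
  next
    case True
    \<comment> \<open>The imaginary part of \<omega>^2 is twice the product of the real and
      imaginary parts of \<omega>, and real \<omega> is excluded by
      \<open>k \<noteq> 0\<close>.\<close>
    then have \<omega>: "Re \<omega> = 0" using mode_nonreal k by (auto simp: power2_eq_square)
    obtain u where u: "u \<in> \<real>" "u \<noteq> 0" "Re (cnj u * response u) \<le> 0"
    proof -
      \<comment> \<open>Applied to the whole plane, \<open>degenerate\<close> could return u = i,
        whose intensity vanishes identically and determines nothing; a real \<open>u\<close> has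
        nonvanishing intensity.\<close>
      have "\<exists>u\<in>\<real>. u \<noteq> 0 \<and> Re (cnj u * response u) \<le> 0"
      proof (rule degenerate[OF subspace_complex_Reals closed_complex_Reals Reals_1])
        fix t z \<eta> \<nu>
        assume "\<bar>t\<bar> \<le> 1" "ybound\<^sup>2 * cmod z \<le> 1" "ivp_solution l (coeff t z) 0 1 \<eta> \<nu>"
        then show "mismatch t (\<eta> l) (\<nu> l) \<in> \<real>" by (rule imaginary_mode_mismatch_real[OF \<omega>])
      qed
      then show thesis using that by blast
    qed
    have "{s \<in> {0<..<l}. intensity u s = 0} = {}"
      using imaginary_mode_intensity_nonzero[OF \<omega> u(1,2)] by blast
    then have "negligible {s \<in> {0<..<l}. intensity u s = 0}" by (simp only: negligible_empty)
    show thesis by (rule extremal_direction[OF u(2,3)]) (fact, rule that)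
  qed
qed

end

section \<open>Reduction of an extremal pair to a normalised mode, and return to the nonlinear
  problem\<close>

theorem theorem5:
  fixes l c \<epsilon>inf \<epsilon>\<^sub>1 \<epsilon>\<^sub>2 \<alpha> :: real and \<omega> :: complex and \<epsilon> :: "real \<Rightarrow> real"
  assumes "l > 0" and "c > 0" and "\<epsilon>inf \<ge> 1" and "1 \<le> \<epsilon>\<^sub>1" and "\<epsilon>\<^sub>1 < \<epsilon>\<^sub>2"
    and "admissible_frequency l c \<epsilon>inf \<epsilon>\<^sub>1 \<epsilon>\<^sub>2 \<alpha>" and "\<alpha> = Re \<omega>"
    and "local_minimizer l c \<epsilon>inf \<epsilon>\<^sub>1 \<epsilon>\<^sub>2 \<alpha> \<omega> \<epsilon> \<or> local_maximizer l c \<epsilon>inf \<epsilon>\<^sub>1 \<epsilon>\<^sub>2 \<alpha> \<omega> \<epsilon>"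
  shows "\<exists>E :: real \<Rightarrow> complex.
    bvp_solution l c \<epsilon>inf \<omega>
      (\<lambda>s. - (\<omega>^2 / (complex_of_real c)^2) * E s
             * complex_of_real (\<epsilon>\<^sub>1 + (\<epsilon>\<^sub>2 - \<epsilon>\<^sub>1) * chi_plus ((E s)^2))) E \<and>
    (\<exists>s\<in>{0..l}. E s \<noteq> 0) \<and>
    (AE s in lebesgue_on {0<..<l}. \<epsilon> s = \<epsilon>\<^sub>1 + (\<epsilon>\<^sub>2 - \<epsilon>\<^sub>1) * chi_plus ((E s)^2))"
proof -
  note l = assms(1) and c = assms(2) and \<epsilon>12 = assms(4,5)
  define k where "k = sqrt \<epsilon>inf / c"
  have k: "k \<noteq> 0" using assms(3) c by (simp add: k_def)
  have pair: "admissible_pair l c \<epsilon>inf \<epsilon>\<^sub>1 \<epsilon>\<^sub>2 \<omega> \<epsilon>"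
    using assms(8) by (auto simp: local_minimizer_def local_maximizer_def)
  \<comment> \<open>A minimal decay rate means a maximal imaginary part, so \<sigma> is 1 for
    minimizers and -1 for maximizers.\<close>
  obtain \<delta> \<sigma> :: real where \<delta>: "\<delta> > 0" and \<sigma>: "\<bar>\<sigma>\<bar> = 1" and opt: "\<And>\<omega>' \<epsilon>'.
      \<lbrakk>admissible_pair l c \<epsilon>inf \<epsilon>\<^sub>1 \<epsilon>\<^sub>2 \<omega>' \<epsilon>'; AE s in lebesgue_on {0<..<l}. \<bar>\<epsilon>' s - \<epsilon> s\<bar> < \<delta>;
      cmod (\<omega>' - \<omega>) < \<delta>; Re \<omega>' = \<alpha>\<rbrakk> \<Longrightarrow> \<sigma> * (Im \<omega>' - Im \<omega>) \<le> 0"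
    using assms(8)
  proof
    assume "local_minimizer l c \<epsilon>inf \<epsilon>\<^sub>1 \<epsilon>\<^sub>2 \<alpha> \<omega> \<epsilon>"
    then obtain \<delta> where "\<delta> > 0" "\<And>\<omega>' \<epsilon>'. \<lbrakk>admissible_pair l c \<epsilon>inf \<epsilon>\<^sub>1 \<epsilon>\<^sub>2 \<omega>' \<epsilon>';
      AE s in lebesgue_on {0<..<l}. \<bar>\<epsilon>' s - \<epsilon> s\<bar> < \<delta>; cmod (\<omega>' - \<omega>) < \<delta>; Re \<omega>' = \<alpha>\<rbrakk> \<Longrightarrow> - Im \<omega> \<le> - Im \<omega>'"
      unfolding local_minimizer_def decay_rate_def by blast
    then show thesis by (intro that[of \<delta> 1]) (simp_all only: abs_one mult_1 neg_le_iff_le diff_le_0_iff_le)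
  next
    assume "local_maximizer l c \<epsilon>inf \<epsilon>\<^sub>1 \<epsilon>\<^sub>2 \<alpha> \<omega> \<epsilon>"
    then obtain \<delta> where "\<delta> > 0" "\<And>\<omega>' \<epsilon>'. \<lbrakk>admissible_pair l c \<epsilon>inf \<epsilon>\<^sub>1 \<epsilon>\<^sub>2 \<omega>' \<epsilon>';
      AE s in lebesgue_on {0<..<l}. \<bar>\<epsilon>' s - \<epsilon> s\<bar> < \<delta>; cmod (\<omega>' - \<omega>) < \<delta>; Re \<omega>' = \<alpha>\<rbrakk> \<Longrightarrow> - Im \<omega>' \<le> - Im \<omega>"
      unfolding local_maximizer_def decay_rate_def by blast
    then show thesis by (intro that[of \<delta> "-1"]) (simp_all only: abs_one abs_minus_cancel mult_minus1 minus_diff_eq neg_le_iff_le diff_le_0_iff_le)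
  qed
  have \<epsilon>m: "\<epsilon> \<in> borel_measurable (lebesgue_on {0<..<l})"
    and \<epsilon>b: "AE s in lebesgue_on {0<..<l}. \<epsilon>\<^sub>1 \<le> \<epsilon> s \<and> \<epsilon> s \<le> \<epsilon>\<^sub>2" and qn: "qn_eigenvalue l c \<epsilon>inf \<epsilon> \<omega>"
    using pair by (auto simp: admissible_pair_def admissible_cavity_def)
  \<comment> \<open>A representative clamped into the admissible range at every point and equal to
    the lower bound outside the cavity. Adding that bound to a function extended by zero gives
    measurability on the whole line.\<close>
  define \<epsilon>0 where "\<epsilon>0 s = \<epsilon>\<^sub>1 + (if s \<in> {0<..<l} then max \<epsilon>\<^sub>1 (min \<epsilon>\<^sub>2 (\<epsilon> s)) - \<epsilon>\<^sub>1 else 0)" for s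
  have \<epsilon>0b: "\<epsilon>\<^sub>1 \<le> \<epsilon>0 s \<and> \<epsilon>0 s \<le> \<epsilon>\<^sub>2" for s using \<epsilon>12 by (auto simp: \<epsilon>0_def)
  have "(\<lambda>s. max \<epsilon>\<^sub>1 (min \<epsilon>\<^sub>2 (\<epsilon> s)) - \<epsilon>\<^sub>1) \<in> borel_measurable (lebesgue_on {0<..<l})"
    by (intro borel_measurable_diff borel_measurable_max borel_measurable_min borel_measurable_const \<epsilon>m)
  then have "(\<lambda>s. if s \<in> {0<..<l} then max \<epsilon>\<^sub>1 (min \<epsilon>\<^sub>2 (\<epsilon> s)) - \<epsilon>\<^sub>1 else 0) \<in> borel_measurable lebesgue"
    by (rule borel_measurable_if_I) simp
  then have "\<epsilon>0 \<in> borel_measurable lebesgue"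
    unfolding \<epsilon>0_def by (intro borel_measurable_add borel_measurable_const)
  then have \<epsilon>0m: "\<epsilon>0 \<in> borel_measurable (lebesgue_on {0..l})" by (rule measurable_restrict_space1)
  have in_interval: "AE s in lebesgue_on {0<..<l}. s \<in> {0<..<l}"
    by (rule AE_lebesgue_onI[of "{}"]) auto
  have eq: "AE s in lebesgue_on {0<..<l}. \<epsilon> s = \<epsilon>0 s"
    using \<epsilon>b in_interval by eventually_elim (auto simp: \<epsilon>0_def)
  define q where "q x = - (\<omega>\<^sup>2 / (complex_of_real c)\<^sup>2) * complex_of_real (\<epsilon>0 x)" for x
  have q: "bounded_coefficient l (cmod (\<omega>\<^sup>2 / (complex_of_real c)\<^sup>2) * \<epsilon>\<^sub>2) q"
    unfolding bounded_coefficient_def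
  proof (intro conjI ballI)
    show "q \<in> borel_measurable (lebesgue_on {0..l})"
      unfolding q_def
      by (intro borel_measurable_times borel_measurable_const measurable_compose[OF \<epsilon>0m borel_measurable_of_real])
    show "norm (q x) \<le> cmod (\<omega>\<^sup>2 / (complex_of_real c)\<^sup>2) * \<epsilon>\<^sub>2" for x
      unfolding q_def norm_mult norm_minus_cancel norm_of_real using \<epsilon>0b[of x] \<epsilon>12 by (intro mult_left_mono) auto
  qed
  have "AE s in lebesgue_on {0<..<l}. - (\<omega>\<^sup>2 / (complex_of_real c)\<^sup>2) * complex_of_real (\<epsilon> s) = q s"
    using eq by eventually_elim (simp add: q_def)
  then obtain y v where sol_q: "ivp_solution l q 0 1 y v" and bc: "v l = \<i> * \<omega> * complex_of_real k * y l"
    unfolding k_def using qn_eigenvalue_ivp[OF l qn q] by blast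
  interpret cavity_mode l c k \<epsilon>\<^sub>1 \<epsilon>\<^sub>2 \<epsilon>0 \<omega> y v
    by unfold_locales (use l c \<epsilon>12 \<epsilon>0m \<epsilon>0b sol_q[unfolded q_def] bc in auto)
  obtain \<kappa> where \<kappa>: "\<kappa> \<noteq> 0"
    and prof: "AE s in lebesgue_on {0<..<l}. \<epsilon>0 s = \<epsilon>\<^sub>1 + (\<epsilon>\<^sub>2 - \<epsilon>\<^sub>1) * chi_plus ((\<kappa> * y s)\<^sup>2)"
  proof (rule extremal_profile[OF k \<delta> \<sigma>])
    fix \<epsilon>' q' \<eta> \<nu> t
    assume m: "\<epsilon>' \<in> borel_measurable (lebesgue_on {0..l})"
      and b: "\<And>x. x \<in> {0..l} \<Longrightarrow> \<epsilon>\<^sub>1 \<le> \<epsilon>' x \<and> \<epsilon>' x \<le> \<epsilon>\<^sub>2 \<and> \<bar>\<epsilon>' x - \<epsilon>0 x\<bar> < \<delta>"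
      and q': "\<And>x. q' x = - ((\<omega> + \<i> * complex_of_real t)\<^sup>2 / (complex_of_real c)\<^sup>2) * complex_of_real (\<epsilon>' x)"
        "bounded_coefficient l qbound q'" "ivp_solution l q' 0 1 \<eta> \<nu>"
      and bc': "\<nu> l = \<i> * (\<omega> + \<i> * complex_of_real t) * complex_of_real k * \<eta> l" and t: "\<bar>t\<bar> < \<delta>"
    have b': "AE s in lebesgue_on {0<..<l}. \<epsilon>\<^sub>1 \<le> \<epsilon>' s \<and> \<epsilon>' s \<le> \<epsilon>\<^sub>2 \<and> \<bar>\<epsilon>' s - \<epsilon>0 s\<bar> < \<delta>"
    proof (rule AE_lebesgue_onI[of "{}"])
      show "\<epsilon>\<^sub>1 \<le> \<epsilon>' s \<and> \<epsilon>' s \<le> \<epsilon>\<^sub>2 \<and> \<bar>\<epsilon>' s - \<epsilon>0 s\<bar> < \<delta>" if "s \<in> {0<..<l} - {}" for s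
        by (rule b) (use that in auto)
    qed simp_all
    have "\<epsilon>' \<in> borel_measurable (lebesgue_on {0<..<l})"
      by (rule measurable_restrict_mono[OF m]) auto
    moreover have "AE s in lebesgue_on {0<..<l}. \<epsilon>\<^sub>1 \<le> \<epsilon>' s \<and> \<epsilon>' s \<le> \<epsilon>\<^sub>2"
      using b' by eventually_elim simp
    moreover have "qn_eigenvalue l c \<epsilon>inf \<epsilon>' (\<omega> + \<i> * complex_of_real t)"
      by (rule qn_eigenvalueI[OF l q'(3,2) q'(1) bc'[unfolded k_def]])
    ultimately have "admissible_pair l c \<epsilon>inf \<epsilon>\<^sub>1 \<epsilon>\<^sub>2 (\<omega> + \<i> * complex_of_real t) \<epsilon>'"
      by (simp add: admissible_pair_def admissible_cavity_def)
    moreover have "AE s in lebesgue_on {0<..<l}. \<bar>\<epsilon>' s - \<epsilon> s\<bar> < \<delta>"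
      using b' eq by eventually_elim simp
    ultimately have "\<sigma> * (Im (\<omega> + \<i> * complex_of_real t) - Im \<omega>) \<le> 0"
      by (rule opt) (use t assms(7) in \<open>simp_all add: norm_mult\<close>)
    then show "\<sigma> * t \<le> 0" by simp
  qed
  define E where "E s = \<kappa> * y s" for s
  have prof': "AE s in lebesgue_on {0<..<l}. \<epsilon> s = \<epsilon>\<^sub>1 + (\<epsilon>\<^sub>2 - \<epsilon>\<^sub>1) * chi_plus ((E s)\<^sup>2)"
    using eq prof by eventually_elim (simp add: E_def)
  \<comment> \<open>Scaling preserves the linear equation with coefficient \<open>q\<close> and the
    boundary condition, while it rotates E^2 so that the sign of its imaginary part selects the
    profile.\<close>
  have solE: "ivp_solution l q 0 \<kappa> E (\<lambda>s. \<kappa> * v s)"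
    using ivp_solution_scale[OF sol_q, of \<kappa>] unfolding E_def by simp
  have "AE s in lebesgue_on {0<..<l}. q s * E s = - (\<omega>\<^sup>2 / (complex_of_real c)\<^sup>2) * E s
      * complex_of_real (\<epsilon>\<^sub>1 + (\<epsilon>\<^sub>2 - \<epsilon>\<^sub>1) * chi_plus ((E s)\<^sup>2))"
    using prof unfolding E_def[symmetric]
  proof eventually_elim
    fix s assume e: "\<epsilon>0 s = \<epsilon>\<^sub>1 + (\<epsilon>\<^sub>2 - \<epsilon>\<^sub>1) * chi_plus ((E s)\<^sup>2)"
    show "q s * E s = - (\<omega>\<^sup>2 / (complex_of_real c)\<^sup>2) * E s
      * complex_of_real (\<epsilon>\<^sub>1 + (\<epsilon>\<^sub>2 - \<epsilon>\<^sub>1) * chi_plus ((E s)\<^sup>2))"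
      unfolding q_def e[symmetric] by (simp only: mult_ac)
  qed
  then have "bvp_solution l c \<epsilon>inf \<omega> (\<lambda>s. - (\<omega>\<^sup>2 / (complex_of_real c)\<^sup>2) * E s
      * complex_of_real (\<epsilon>\<^sub>1 + (\<epsilon>\<^sub>2 - \<epsilon>\<^sub>1) * chi_plus ((E s)\<^sup>2))) E"
    by (rule bvp_solutionI[OF l solE q]) (simp add: bc E_def k_def)
  moreover have "\<exists>s\<in>{0..l}. E s \<noteq> 0"
    using y_final_nonzero \<kappa> l by (intro bexI[of _ l]) (auto simp: E_def)
  ultimately show ?thesis using prof' by blast
qed

end
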